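(* Let $L$ be a metric signature. The continuous theory $\mathrm{SCP}$ is preserved under reduced products: for every family $(M_i)_{i\in I}$ of $L$-structures and every filter $F$ on $I$ such that $\{i\in I: M_i\models\mathrm{SCP}\}\in F$, we have $\prod_iM_i/F\models\mathrm{SCP}$.
   Context: Continuous first-order logic. The domains of (metric) $L$-structures are nonempty complete bounded metric spaces; predicates are bounded uniformly continuous real-valued maps, with bounds and moduli of uniform continuity prescribed by the signature. Formulas are built from atomic formulas (predicates, including the metric $d$, applied to terms) using continuous connectives $\mathbb R^n\to\mathbb R$ and the quantifiers $\sup,\inf$; formulas are $\mathbb R$-valued. A unary connective is a continuous map $\mathbb R\to\mathbb R$. A theory is a set of conditions such as $\varphi\le r$, with $\varphi$ a sentence and $r\in\mathbb R$. All filters are proper filters on nonempty sets. For a bounded family of reals, $\limsup_{i\to F}u_i=\inf_{J\in F}\sup_{i\in J}u_i$. Reduced products: on $\prod_i M_i$ let $d_F(a,b)=\limsup_{i\to F}d^{M_i}(a_i,b_i)$. The reduced product $M_F=\prod_i M_i/F$ has as domain the quotient of $\prod_iM_i$ by $d_F(a,b)=0$ (a complete bounded metric space); $a_F$ denotes the image of $a$; constants and functions are interpreted coordinatewise, and $p^{M_F}(a_F)=\limsup_{i\to F}p^{M_i}(a_i)$ for predicate symbols $p$. Palyutin formulas: the smallest set of formulas such that (1) every atomic formula is Palyutin; (2) if $\varphi$ is Palyutin and $C$ is a nondecreasing unary connective, then $C\varphi$ is Palyutin; (3) if $\varphi,\psi$ are Palyutin, so is $\max(\varphi,\psi)$; (4)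 if $\varphi$ is Palyutin and $x$ is a variable, $\inf_x\varphi$ and $\sup_x\varphi$ are Palyutin; (5) if $\varphi,\psi$ are Palyutin, $D$ is a nonincreasing unary connective with (necessarily unique) fixed point $\Delta$, and $x$ is a variable, then $\max(\inf_x\varphi,\ \sup_x\min(D\varphi,\Delta,\psi))$ is Palyutin. $\mathrm{SCP}$ is the theory consisting of the conditions \[\sup_y\Big(\inf_x\max(\varphi,D_1\psi_1,\dots,D_n\psi_n)-\max_{1\le j\le n}\inf_x\max(\varphi,D_j\psi_j)\Big)\le 0\] for all $n\ge2$, all Palyutin formulas $\varphi(x,y),\psi_1(x,y),\dots,\psi_n(x,y)$ ($x,y$ tuples of variables) and all nonincreasing unary connectives $D_1,\dots,D_n$. *)

theory Defs
  imports "HOL-Analysis.Analysis"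
begin

section \<open>Metric signatures and metric structures\<close>

text \<open>The symbols of a signature form subsets of the types \<open>'f\<close> and \<open>'p\<close>, so that a signature may
  well lack function or predicate symbols.  Constants are function symbols of arity \<open>0\<close>.  The metric
  is a logical symbol; the signature only prescribes a bound for it.\<close>

record ('f, 'p) signature =
  funs :: "'f set"
  fun_arity :: "'f \<Rightarrow> nat"
  fun_modulus :: "'f \<Rightarrow> real \<Rightarrow> real"
  preds :: "'p set"
  pred_arity :: "'p \<Rightarrow> nat"
  pred_lower :: "'p \<Rightarrow> real"
  pred_upper :: "'p \<Rightarrow> real"
  pred_modulus :: "'p \<Rightarrow> real \<Rightarrow> real"
  diameter_bound :: real

definition metric_signature :: "('f, 'p) signature \<Rightarrow> bool" where
  "metric_signature L \<longleftrightarrow>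
     0 \<le> diameter_bound L \<and>
     (\<forall>f \<in> funs L. \<forall>\<epsilon>>0. 0 < fun_modulus L f \<epsilon>) \<and>
     (\<forall>p \<in> preds L. pred_lower L p \<le> pred_upper L p \<and> (\<forall>\<epsilon>>0. 0 < pred_modulus L p \<epsilon>))"

record ('a, 'f, 'p) mstructure =
  universe :: "'a set"
  distance :: "'a \<Rightarrow> 'a \<Rightarrow> real"
  fun_interp :: "'f \<Rightarrow> 'a list \<Rightarrow> 'a"
  pred_interp :: "'p \<Rightarrow> 'a list \<Rightarrow> real"

text \<open>A modulus \<open>\<delta>\<close> is respected if tuples which are coordinatewise closer than \<open>\<delta> \<epsilon>\<close> have values
  at distance at most \<open>\<epsilon>\<close>.\<close>

definition L_structure :: "('f, 'p) signature \<Rightarrow> ('a, 'f, 'p) mstructure \<Rightarrow> bool" where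
  "L_structure L M \<longleftrightarrow>
     universe M \<noteq> {} \<and>
     Metric_space (universe M) (distance M) \<and>
     Metric_space.mcomplete (universe M) (distance M) \<and>
     (\<forall>x \<in> universe M. \<forall>y \<in> universe M. distance M x y \<le> diameter_bound L) \<and>
     (\<forall>f \<in> funs L. \<forall>xs \<in> lists (universe M). length xs = fun_arity L f \<longrightarrow>
        fun_interp M f xs \<in> universe M) \<and>
     (\<forall>f \<in> funs L. \<forall>\<epsilon>>0. \<forall>xs \<in> lists (universe M). \<forall>ys \<in> lists (universe M).
        length xs = fun_arity L f \<longrightarrow>
        list_all2 (\<lambda>x y. distance M x y < fun_modulus L f \<epsilon>) xs ys \<longrightarrow>
        distance M (fun_interp M f xs) (fun_interp M f ys) \<le> \<epsilon>) \<and>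
     (\<forall>p \<in> preds L. \<forall>xs \<in> lists (universe M). length xs = pred_arity L p \<longrightarrow>
        pred_interp M p xs \<in> {pred_lower L p..pred_upper L p}) \<and>
     (\<forall>p \<in> preds L. \<forall>\<epsilon>>0. \<forall>xs \<in> lists (universe M). \<forall>ys \<in> lists (universe M).
        length xs = pred_arity L p \<longrightarrow>
        list_all2 (\<lambda>x y. distance M x y < pred_modulus L p \<epsilon>) xs ys \<longrightarrow>
        \<bar>pred_interp M p xs - pred_interp M p ys\<bar> \<le> \<epsilon>)"


section \<open>Continuous first-order formulas\<close>

datatype 'f trm = Var nat | Fn 'f "'f trm list"

text \<open>In \<open>Conn u [\<phi>\<^sub>0, \<dots>, \<phi>\<^sub>n\<^sub>-\<^sub>1]\<close> the connective \<open>u\<close> is a map from \<open>\<real>\<^sup>n\<close> to \<open>\<real>\<close>, where \<open>\<real>\<^sup>n\<close> is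
  the space of extensional functions on \<open>{..<n}\<close>.\<close>

datatype ('f, 'p) form =
    Dist "'f trm" "'f trm"
  | Pred 'p "'f trm list"
  | Conn "(nat \<Rightarrow> real) \<Rightarrow> real" "('f, 'p) form list"
  | SupF nat "('f, 'p) form"
  | InfF nat "('f, 'p) form"

inductive wf_trm :: "('f, 'p) signature \<Rightarrow> 'f trm \<Rightarrow> bool" for L where
  "wf_trm L (Var x)"
| "\<lbrakk>f \<in> funs L; length ts = fun_arity L f; \<forall>t \<in> set ts. wf_trm L t\<rbrakk> \<Longrightarrow> wf_trm L (Fn f ts)"

inductive atomic_form :: "('f, 'p) signature \<Rightarrow> ('f, 'p) form \<Rightarrow> bool" for L where
  "\<lbrakk>wf_trm L s; wf_trm L t\<rbrakk> \<Longrightarrow> atomic_form L (Dist s t)"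
| "\<lbrakk>p \<in> preds L; length ts = pred_arity L p; \<forall>t \<in> set ts. wf_trm L t\<rbrakk> \<Longrightarrow> atomic_form L (Pred p ts)"

definition connective :: "nat \<Rightarrow> ((nat \<Rightarrow> real) \<Rightarrow> real) \<Rightarrow> bool" where
  "connective n u \<longleftrightarrow>
     continuous_map (product_topology (\<lambda>_. euclideanreal) {..<n}) euclideanreal u"

inductive wf_form :: "('f, 'p) signature \<Rightarrow> ('f, 'p) form \<Rightarrow> bool" for L where
  "atomic_form L \<phi> \<Longrightarrow> wf_form L \<phi>"
| "\<lbrakk>connective (length \<phi>s) u; \<forall>\<phi> \<in> set \<phi>s. wf_form L \<phi>\<rbrakk> \<Longrightarrow> wf_form L (Conn u \<phi>s)"
| "wf_form L \<phi> \<Longrightarrow> wf_form L (SupF x \<phi>)"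
| "wf_form L \<phi> \<Longrightarrow> wf_form L (InfF x \<phi>)"

primrec trm_vars :: "'f trm \<Rightarrow> nat set" where
  "trm_vars (Var x) = {x}"
| "trm_vars (Fn f ts) = \<Union> (set (map trm_vars ts))"

primrec free_vars :: "('f, 'p) form \<Rightarrow> nat set" where
  "free_vars (Dist s t) = trm_vars s \<union> trm_vars t"
| "free_vars (Pred p ts) = \<Union> (set (map trm_vars ts))"
| "free_vars (Conn u \<phi>s) = \<Union> (set (map free_vars \<phi>s))"
| "free_vars (SupF x \<phi>) = free_vars \<phi> - {x}"
| "free_vars (InfF x \<phi>) = free_vars \<phi> - {x}"

definition sentence :: "('f, 'p) signature \<Rightarrow> ('f, 'p) form \<Rightarrow> bool" where
  "sentence L \<phi> \<longleftrightarrow> wf_form L \<phi> \<and> free_vars \<phi> = {}"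

primrec trm_value :: "('a, 'f, 'p) mstructure \<Rightarrow> (nat \<Rightarrow> 'a) \<Rightarrow> 'f trm \<Rightarrow> 'a" where
  "trm_value M \<sigma> (Var x) = \<sigma> x"
| "trm_value M \<sigma> (Fn f ts) = fun_interp M f (map (trm_value M \<sigma>) ts)"

primrec form_value :: "('a, 'f, 'p) mstructure \<Rightarrow> ('f, 'p) form \<Rightarrow> (nat \<Rightarrow> 'a) \<Rightarrow> real" where
  "form_value M (Dist s t) = (\<lambda>\<sigma>. distance M (trm_value M \<sigma> s) (trm_value M \<sigma> t))"
| "form_value M (Pred p ts) = (\<lambda>\<sigma>. pred_interp M p (map (trm_value M \<sigma>) ts))"
| "form_value M (Conn u \<phi>s) =
     (\<lambda>\<sigma>. u (\<lambda>i\<in>{..<length \<phi>s}. (map (form_value M) \<phi>s ! i) \<sigma>))"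
| "form_value M (SupF x \<phi>) = (\<lambda>\<sigma>. SUP a\<in>universe M. form_value M \<phi> (\<sigma>(x := a)))"
| "form_value M (InfF x \<phi>) = (\<lambda>\<sigma>. INF a\<in>universe M. form_value M \<phi> (\<sigma>(x := a)))"

text \<open>The pair \<open>(\<phi>, r)\<close> stands for the condition \<open>\<phi> \<le> r\<close>.\<close>

type_synonym ('f, 'p) condition = "('f, 'p) form \<times> real"

definition is_theory :: "('f, 'p) signature \<Rightarrow> ('f, 'p) condition set \<Rightarrow> bool" where
  "is_theory L T \<longleftrightarrow> (\<forall>(\<phi>, r) \<in> T. sentence L \<phi>)"

definition models :: "('a, 'f, 'p) mstructure \<Rightarrow> ('f, 'p) condition set \<Rightarrow> bool" (infix "\<Turnstile>" 50) where
  "M \<Turnstile> T \<longleftrightarrow> (\<forall>(\<phi>, r) \<in> T. \<forall>\<sigma>. range \<sigma> \<subseteq> universe M \<longrightarrow> form_value M \<phi> \<sigma> \<le> r)"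


section \<open>Reduced products\<close>

definition limsup_filter :: "'i filter \<Rightarrow> ('i \<Rightarrow> real) \<Rightarrow> real" where
  "limsup_filter F u = (INF J \<in> {J. \<forall>\<^sub>F i in F. i \<in> J}. SUP i\<in>J. u i)"

definition prod_universe :: "('i \<Rightarrow> ('a, 'f, 'p) mstructure) \<Rightarrow> ('i \<Rightarrow> 'a) set" where
  "prod_universe M = (\<Pi> i\<in>UNIV. universe (M i))"

definition prod_dist ::
    "'i filter \<Rightarrow> ('i \<Rightarrow> ('a, 'f, 'p) mstructure) \<Rightarrow> ('i \<Rightarrow> 'a) \<Rightarrow> ('i \<Rightarrow> 'a) \<Rightarrow> real" where
  "prod_dist F M a b = limsup_filter F (\<lambda>i. distance (M i) (a i) (b i))"

definition prod_rel ::
    "'i filter \<Rightarrow> ('i \<Rightarrow> ('a, 'f, 'p) mstructure) \<Rightarrow> (('i \<Rightarrow> 'a) \<times> ('i \<Rightarrow> 'a)) set" where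
  "prod_rel F M = {(a, b) \<in> prod_universe M \<times> prod_universe M. prod_dist F M a b = 0}"

definition representative :: "('i \<Rightarrow> 'a) set \<Rightarrow> 'i \<Rightarrow> 'a" where
  "representative A = (SOME a. a \<in> A)"

text \<open>Elements are equivalence classes, and the interpretations are evaluated on representatives
  (they do not depend on the choice, by uniform continuity).  The distance is set to \<open>0\<close> outside of
  the universe because \<^locale>\<open>Metric_space\<close> asks for symmetry and nonnegativity on the whole type.\<close>

definition reduced_product ::
    "'i filter \<Rightarrow> ('i \<Rightarrow> ('a, 'f, 'p) mstructure) \<Rightarrow> (('i \<Rightarrow> 'a) set, 'f, 'p) mstructure" where
  "reduced_product F M =
     \<lparr> universe = prod_universe M // prod_rel F M,
       distance = (\<lambda>A B. if A \<in> prod_universe M // prod_rel F M \<and> B \<in> prod_universe M // prod_rel F M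
          then prod_dist F M (representative A) (representative B) else 0),
       fun_interp = (\<lambda>f As.
          prod_rel F M `` {\<lambda>i. fun_interp (M i) f (map (\<lambda>A. representative A i) As)}),
       pred_interp = (\<lambda>p As.
          limsup_filter F (\<lambda>i. pred_interp (M i) p (map (\<lambda>A. representative A i) As))) \<rparr>"


section \<open>Palyutin formulas and the theory SCP\<close>

definition unary_connective :: "(real \<Rightarrow> real) \<Rightarrow> bool" where
  "unary_connective C \<longleftrightarrow> continuous_on UNIV C"

definition Unary :: "(real \<Rightarrow> real) \<Rightarrow> ('f, 'p) form \<Rightarrow> ('f, 'p) form" where
  "Unary C \<phi> = Conn (\<lambda>v. C (v 0)) [\<phi>]"

definition Const :: "real \<Rightarrow> ('f, 'p) form" where
  "Const r = Conn (\<lambda>_. r) []"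

definition Diff :: "('f, 'p) form \<Rightarrow> ('f, 'p) form \<Rightarrow> ('f, 'p) form" where
  "Diff \<phi> \<psi> = Conn (\<lambda>v. v 0 - v 1) [\<phi>, \<psi>]"

definition MaxF :: "('f, 'p) form list \<Rightarrow> ('f, 'p) form" where
  "MaxF \<phi>s = Conn (\<lambda>v. Max (v ` {..<length \<phi>s})) \<phi>s"

definition MinF :: "('f, 'p) form list \<Rightarrow> ('f, 'p) form" where
  "MinF \<phi>s = Conn (\<lambda>v. Min (v ` {..<length \<phi>s})) \<phi>s"

definition SupT :: "nat list \<Rightarrow> ('f, 'p) form \<Rightarrow> ('f, 'p) form" where
  "SupT xs \<phi> = foldr SupF xs \<phi>"

definition InfT :: "nat list \<Rightarrow> ('f, 'p) form \<Rightarrow> ('f, 'p) form" where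
  "InfT xs \<phi> = foldr InfF xs \<phi>"

inductive palyutin :: "('f, 'p) signature \<Rightarrow> ('f, 'p) form \<Rightarrow> bool" for L where
  atomic: "atomic_form L \<phi> \<Longrightarrow> palyutin L \<phi>"
| unary: "\<lbrakk>palyutin L \<phi>; unary_connective C; mono C\<rbrakk> \<Longrightarrow> palyutin L (Unary C \<phi>)"
| max: "\<lbrakk>palyutin L \<phi>; palyutin L \<psi>\<rbrakk> \<Longrightarrow> palyutin L (MaxF [\<phi>, \<psi>])"
| inf: "palyutin L \<phi> \<Longrightarrow> palyutin L (InfF x \<phi>)"
| sup: "palyutin L \<phi> \<Longrightarrow> palyutin L (SupF x \<phi>)"
| max_inf_sup: "\<lbrakk>palyutin L \<phi>; palyutin L \<psi>; unary_connective D; antimono D; D \<Delta> = \<Delta>\<rbrakk> \<Longrightarrow>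
    palyutin L (MaxF [InfF x \<phi>, SupF x (MinF [Unary D \<phi>, Const \<Delta>, \<psi>])])"

definition SCP_sentence ::
    "nat list \<Rightarrow> nat list \<Rightarrow> ('f, 'p) form \<Rightarrow> (real \<Rightarrow> real) list \<Rightarrow> ('f, 'p) form list \<Rightarrow>
     ('f, 'p) form" where
  "SCP_sentence xs ys \<phi> Ds \<psi>s =
     SupT ys (Diff
       (InfT xs (MaxF (\<phi> # map2 Unary Ds \<psi>s)))
       (MaxF (map2 (\<lambda>D \<psi>. InfT xs (MaxF [\<phi>, Unary D \<psi>])) Ds \<psi>s)))"

definition SCP :: "('f, 'p) signature \<Rightarrow> ('f, 'p) condition set" where
  "SCP L = {(SCP_sentence xs ys \<phi> Ds \<psi>s, 0) | xs ys \<phi> Ds \<psi>s.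
     distinct (xs @ ys) \<and>
     length Ds \<ge> 2 \<and> length \<psi>s = length Ds \<and>
     palyutin L \<phi> \<and> (\<forall>\<psi> \<in> set \<psi>s. palyutin L \<psi>) \<and>
     (\<forall>\<theta> \<in> set (\<phi> # \<psi>s). free_vars \<theta> \<subseteq> set xs \<union> set ys) \<and>
     (\<forall>D \<in> set Ds. unary_connective D \<and> antimono D)}"

lemma connective_coordinate: "i < n \<Longrightarrow> connective n (\<lambda>v. v i)"
  unfolding connective_def by (rule continuous_map_product_projection) simp

lemma connective_unary:
  assumes "unary_connective C"
  shows "connective 1 (\<lambda>v. C (v 0))"
  using continuous_map_compose[OF connective_coordinate[of 0 1, unfolded connective_def], of euclideanreal C]
    assms by (simp add: connective_def unary_connective_def o_def)

lemma connective_Max: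
  assumes "0 < n"
  shows "connective n (\<lambda>v. Max (v ` {..<n}))"
proof -
  have "0 < m \<Longrightarrow> m \<le> n \<Longrightarrow> connective n (\<lambda>v. Max (v ` {..<m}))" for m
  proof (induction m)
    case (Suc m)
    show ?case
    proof (cases "m = 0")
      case True
      then show ?thesis using Suc.prems connective_coordinate[of 0 n] by (simp add: lessThan_Suc)
    next
      case False
      then have "Max (v ` {..<Suc m}) = max (v m) (Max (v ` {..<m}))" for v :: "nat \<Rightarrow> real"
        by (simp add: lessThan_Suc lessThan_empty_iff)
      then show ?thesis
        using Suc False connective_coordinate[of m n]
        by (simp add: connective_def continuous_map_real_max)
    qed
  qed simp
  from this[of n] assms show ?thesis by simp
qed

lemma connective_Min:
  assumes "0 < n"
  shows "connective n (\<lambda>v. Min (v ` {..<n}))"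
proof -
  have "0 < m \<Longrightarrow> m \<le> n \<Longrightarrow> connective n (\<lambda>v. Min (v ` {..<m}))" for m
  proof (induction m)
    case (Suc m)
    show ?case
    proof (cases "m = 0")
      case True
      then show ?thesis using Suc.prems connective_coordinate[of 0 n] by (simp add: lessThan_Suc)
    next
      case False
      then have "Min (v ` {..<Suc m}) = min (v m) (Min (v ` {..<m}))" for v :: "nat \<Rightarrow> real"
        by (simp add: lessThan_Suc lessThan_empty_iff)
      then show ?thesis
        using Suc False connective_coordinate[of m n]
        by (simp add: connective_def continuous_map_real_min)
    qed
  qed simp
  from this[of n] assms show ?thesis by simp
qed

lemma wf_form_Unary: "\<lbrakk>wf_form L \<phi>; unary_connective C\<rbrakk> \<Longrightarrow> wf_form L (Unary C \<phi>)"
  unfolding Unary_def using connective_unary by (intro wf_form.intros(2)) auto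

lemma wf_form_Const: "wf_form L (Const r)"
  unfolding Const_def by (rule wf_form.intros(2)) (auto simp: connective_def)

lemma wf_form_Diff: "\<lbrakk>wf_form L \<phi>; wf_form L \<psi>\<rbrakk> \<Longrightarrow> wf_form L (Diff \<phi> \<psi>)"
  unfolding Diff_def
  using connective_coordinate[of 0 2] connective_coordinate[of 1 2]
  by (intro wf_form.intros(2)) (auto simp: connective_def numeral_2_eq_2 continuous_map_diff)

lemma wf_form_MaxF: "\<lbrakk>\<phi>s \<noteq> []; \<forall>\<phi> \<in> set \<phi>s. wf_form L \<phi>\<rbrakk> \<Longrightarrow> wf_form L (MaxF \<phi>s)"
  unfolding MaxF_def using connective_Max by (intro wf_form.intros(2)) auto

lemma wf_form_MinF: "\<lbrakk>\<phi>s \<noteq> []; \<forall>\<phi> \<in> set \<phi>s. wf_form L \<phi>\<rbrakk> \<Longrightarrow> wf_form L (MinF \<phi>s)"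
  unfolding MinF_def using connective_Min by (intro wf_form.intros(2)) auto

lemma wf_form_SupT: "wf_form L \<phi> \<Longrightarrow> wf_form L (SupT xs \<phi>)"
  by (induction xs) (auto simp: SupT_def intro: wf_form.intros)

lemma wf_form_InfT: "wf_form L \<phi> \<Longrightarrow> wf_form L (InfT xs \<phi>)"
  by (induction xs) (auto simp: InfT_def intro: wf_form.intros)

lemma palyutin_wf_form: "palyutin L \<phi> \<Longrightarrow> wf_form L \<phi>"
  by (induction rule: palyutin.induct)
    (auto intro!: wf_form_Unary wf_form_MaxF wf_form_MinF wf_form_Const wf_form.intros(3,4) intro: wf_form.intros(1))

lemma free_vars_derived [simp]:
  "free_vars (Unary C \<phi>) = free_vars \<phi>"
  "free_vars (Diff \<phi> \<psi>) = free_vars \<phi> \<union> free_vars \<psi>"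
  "free_vars (MaxF \<phi>s) = \<Union> (free_vars ` set \<phi>s)"
  by (auto simp: Unary_def Diff_def MaxF_def)

lemma free_vars_tuple [simp]:
  "free_vars (SupT xs \<phi>) = free_vars \<phi> - set xs"
  "free_vars (InfT xs \<phi>) = free_vars \<phi> - set xs"
  by (induction xs) (auto simp: SupT_def InfT_def)

lemma SCP_is_theory: "is_theory L (SCP L)"
proof -
  have "sentence L (SCP_sentence xs ys \<phi> Ds \<psi>s)"
    if "length Ds \<ge> 2" "length \<psi>s = length Ds" "palyutin L \<phi>" "\<forall>\<psi> \<in> set \<psi>s. palyutin L \<psi>"
      and fv: "\<forall>\<theta> \<in> set (\<phi> # \<psi>s). free_vars \<theta> \<subseteq> set xs \<union> set ys"
      and "\<forall>D \<in> set Ds. unary_connective D \<and> antimono D" for xs ys \<phi> Ds \<psi>s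
  proof -
    have "wf_form L \<phi>"
      using that by (simp add: palyutin_wf_form)
    moreover have "unary_connective D \<and> wf_form L \<psi>" if "(D, \<psi>) \<in> set (zip Ds \<psi>s)" for D \<psi>
      using set_zip_leftD[OF that] set_zip_rightD[OF that] \<open>\<forall>\<psi> \<in> set \<psi>s. palyutin L \<psi>\<close>
        \<open>\<forall>D \<in> set Ds. unary_connective D \<and> antimono D\<close> palyutin_wf_form by blast
    moreover have "zip Ds \<psi>s \<noteq> []"
      using that by (cases Ds; cases \<psi>s) auto
    ultimately have "wf_form L (SCP_sentence xs ys \<phi> Ds \<psi>s)"
      unfolding SCP_sentence_def
      by (fastforce intro!: wf_form_SupT wf_form_InfT wf_form_Diff wf_form_MaxF wf_form_Unary)
    moreover have "free_vars (SCP_sentence xs ys \<phi> Ds \<psi>s) = {}"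
      unfolding SCP_sentence_def using fv by (fastforce dest: set_zip_rightD)
    ultimately show ?thesis by (simp add: sentence_def)
  qed
  then show ?thesis by (auto simp: is_theory_def SCP_def)
qed

end

theory Submission imports Defs begin

text \<open>Whether or not the factors satisfy SCP, the value of a Palyutin formula in a reduced product is
  the limit superior of its values in the factors.  For formulas of the form (5) this is where the
  fixed point matters: at the indices where no point makes the second part large, one picks a point
  with \<open>\<phi>\<close> below \<open>\<Delta>\<close>, and then \<open>D \<phi>\<close> is at least \<open>\<Delta>\<close>.  A nonincreasing \<open>D\<close> turns limits superior
  into limits inferior, so \<open>D\<^sub>j \<psi>\<^sub>j < r\<close> at a point of the product means that \<open>D\<^sub>j \<psi>\<^sub>j < r\<close> frequently,
  whereas \<open>\<phi> < r\<close> has to hold eventually.  Given such a point for every \<open>j\<close>, SCP in the factor at \<open>i\<close>,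
  applied to those \<open>j\<close> whose point is good at \<open>i\<close>, glues them into a single one.\<close>

section \<open>Limits superior along a filter\<close>

text \<open>An SCP sentence contains a difference and infima of maxima with nonincreasing
  connectives, so it is not transferred as a whole: only \<phi> and the single \<psi> are computed
  as limits superior, and the infima over the tuple are opened into witnesses. The obstacle is that
  two sets which are each met frequently may be disjoint: points of the product found for different
  j can be good at entirely different indices, and none of them has to serve two values of j. Hence
  the set of those j to which SCP is applied must vary with the index. Each such subset of size at
  least two gives another instance of SCP with the same \<phi>; subsets of size 0 or 1 have no
  instance and are served by the points already at hand. Since a section is an arbitrary choice of
  coordinates, the points from different subsets assemble into one. For each j the new point has to
  be good only frequently, so it inherits all the indices, up to a set of the filter, at which the
  old one was good. Infima need not be attained, so witnesses are sought below a strict bound r, and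
  the resulting bounds \<open>\<le> r\<close> suffice by density.\<close>

lemma eventually_less_limsup_filter:
  assumes "bounded (range u)" and "limsup_filter F u < r"
  shows "\<forall>\<^sub>F i in F. u i < r"
proof -
  have "(\<lambda>J. SUP i\<in>J. u i) ` {J. \<forall>\<^sub>F i in F. i \<in> J} \<noteq> {}"
    using eventually_True by (auto intro: exI[of _ UNIV])
  from cInf_lessD[OF this] assms(2) obtain J
    where J: "\<forall>\<^sub>F i in F. i \<in> J" "(SUP i\<in>J. u i) < r"
    unfolding limsup_filter_def by auto
  have "bdd_above (u ` J)"
    using assms(1) by (meson bounded_imp_bdd_above bdd_above_mono image_mono subset_UNIV)
  then have "i \<in> J \<Longrightarrow> u i < r" for i
    using cSUP_upper J(2) by (metis le_less_trans)
  with J(1) show ?thesis by (simp add: eventually_mono)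
qed

text \<open>Nontriviality keeps every J of the filter nonempty; then all the suprema are at least
  \<open>- B\<close>, and the infimum over J is a genuine one. This lemma and the preceding one are
  the only places where the definition of \<open>limsup_filter\<close> is unfolded.\<close>

lemma limsup_filter_le:
  assumes "bounded (range u)" and "F \<noteq> bot" and "\<forall>\<^sub>F i in F. u i \<le> r"
  shows "limsup_filter F u \<le> r"
proof -
  obtain B where B: "\<And>i. \<bar>u i\<bar> \<le> B"
    using assms(1) by (auto simp: bounded_iff)
  let ?J = "{i. u i \<le> r}"
  have ne: "J \<noteq> {}" if "\<forall>\<^sub>F i in F. i \<in> J" for J
    using that assms(2) by (auto simp: eventually_False)
  have bdd: "bdd_above (u ` J)" for J
    using B by (intro bdd_aboveI2[of _ _ B]) (meson abs_le_D1)
  have "- B \<le> (SUP i\<in>J. u i)" if J: "\<forall>\<^sub>F i in F. i \<in> J" for J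
  proof -
    obtain i where "i \<in> J" using ne[OF J] by blast
    then have "u i \<le> (SUP i\<in>J. u i)" using cSUP_upper bdd by metis
    with B[of i] show ?thesis by linarith
  qed
  then have "bdd_below ((\<lambda>J. SUP i\<in>J. u i) ` {J. \<forall>\<^sub>F i in F. i \<in> J})"
    by (intro bdd_belowI2) auto
  moreover have J: "\<forall>\<^sub>F i in F. i \<in> ?J" using assms(3) by simp
  ultimately have "limsup_filter F u \<le> (SUP i\<in>?J. u i)"
    unfolding limsup_filter_def by (intro cINF_lower) simp_all
  also have "\<dots> \<le> r"
    using ne[OF J] by (intro cSUP_least) auto
  finally show ?thesis .
qed

lemma frequently_less_limsup_filter:
  assumes "bounded (range u)" and "F \<noteq> bot" and "r < limsup_filter F u"
  shows "\<exists>\<^sub>F i in F. r < u i"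
  using limsup_filter_le[OF assms(1,2)] assms(3) by (fastforce simp: frequently_def not_less)

lemma le_limsup_filter:
  assumes "bounded (range u)" and "\<exists>\<^sub>F i in F. r \<le> u i"
  shows "r \<le> limsup_filter F u"
proof (rule ccontr)
  assume "\<not> ?thesis"
  then have "\<forall>\<^sub>F i in F. u i < r"
    by (intro eventually_less_limsup_filter[OF assms(1)]) simp
  with assms(2) show False by (simp add: frequently_def not_le)
qed

lemma le_limsup_filter_eventually:
  assumes "bounded (range u)" and "F \<noteq> bot" and "\<forall>\<^sub>F i in F. r \<le> u i"
  shows "r \<le> limsup_filter F u"
  using assms by (intro le_limsup_filter) (simp_all add: eventually_frequently)

lemma abs_limsup_filter_le:
  assumes "F \<noteq> bot" and "\<And>i. \<bar>u i\<bar> \<le> B"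
  shows "\<bar>limsup_filter F u\<bar> \<le> B"
proof -
  have bd: "bounded (range u)" using assms(2) by (auto simp: bounded_iff)
  have "limsup_filter F u \<le> B"
    using assms by (intro limsup_filter_le bd always_eventually) (auto intro: abs_le_D1)
  moreover have "- B \<le> limsup_filter F u"
    using assms by (intro le_limsup_filter_eventually bd always_eventually)
      (auto simp: abs_le_iff minus_le_iff)
  ultimately show ?thesis by linarith
qed

text \<open>Serves to replace the representatives of classes by other members.\<close>

lemma limsup_filter_eq_of_close:
  assumes "bounded (range u)" and "bounded (range v)" and "F \<noteq> bot"
    and "\<And>\<epsilon>. 0 < \<epsilon> \<Longrightarrow> \<forall>\<^sub>F i in F. \<bar>u i - v i\<bar> \<le> \<epsilon>"
  shows "limsup_filter F u = limsup_filter F v"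
proof -
  have le: "limsup_filter F u \<le> limsup_filter F v"
    if "bounded (range u)" "bounded (range v)" "\<And>\<epsilon>. 0 < \<epsilon> \<Longrightarrow> \<forall>\<^sub>F i in F. \<bar>u i - v i\<bar> \<le> \<epsilon>" for u v
  proof (rule field_le_epsilon)
    fix e :: real assume "0 < e"
    then have "\<forall>\<^sub>F i in F. \<bar>u i - v i\<bar> \<le> e / 2" "\<forall>\<^sub>F i in F. v i < limsup_filter F v + e / 2"
      using that(3)[of "e / 2"] by (auto intro!: eventually_less_limsup_filter that)
    then have "\<forall>\<^sub>F i in F. u i \<le> limsup_filter F v + e"
      by eventually_elim linarith
    then show "limsup_filter F u \<le> limsup_filter F v + e"
      using that assms(3) by (intro limsup_filter_le)
  qed
  show ?thesis
    using assms le[of u v] le[of v u] by (simp add: abs_minus_commute antisym)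
qed

section \<open>Monotone connectives and maxima under limits superior\<close>

lemma bounded_range_mono:
  fixes C :: "real \<Rightarrow> real"
  assumes "bounded (range u)" and "mono C \<or> antimono C"
  shows "bounded (range (\<lambda>i. C (u i)))"
proof -
  obtain B where B: "\<And>i. \<bar>u i\<bar> \<le> B"
    using assms(1) by (auto simp: bounded_iff)
  have "\<bar>C (u i)\<bar> \<le> max \<bar>C B\<bar> \<bar>C (- B)\<bar>" for i
  proof -
    have "- B \<le> u i" "u i \<le> B" using B[of i] by linarith+
    then have "C (- B) \<le> C (u i) \<and> C (u i) \<le> C B \<or> C B \<le> C (u i) \<and> C (u i) \<le> C (- B)"
      using assms(2) by (auto simp: mono_def antimono_def)
    then show ?thesis by linarith
  qed
  then show ?thesis by (auto simp: bounded_iff)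
qed

lemma bounded_range_max:
  fixes u v :: "'i \<Rightarrow> real"
  assumes "bounded (range u)" and "bounded (range v)"
  shows "bounded (range (\<lambda>i. max (u i) (v i)))"
proof -
  obtain B C where B: "\<And>i. \<bar>u i\<bar> \<le> B" "\<And>i. \<bar>v i\<bar> \<le> C"
    using assms by (auto simp: bounded_iff)
  have "\<bar>max (u i) (v i)\<bar> \<le> max B C" for i
    using B[of i] by linarith
  then show ?thesis by (auto simp: bounded_iff)
qed

text \<open>A bounded family is eventually below each \<open>t\<close> exceeding its limit superior,
  but possibly never below the limit superior itself, so a connective has to be evaluated slightly
  past that point. Continuity of connectives enters through this lemma and its mirror image.\<close>

lemma continuous_less_right:
  fixes C :: "real \<Rightarrow> real"
  assumes "continuous_on UNIV C" and "C l < r"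
  obtains t where "l < t" and "C t < r"
proof -
  have "\<forall>\<^sub>F x in at_right l. C x < r"
    using assms by (intro order_tendstoD(2)[of C "C l"])
      (auto simp: continuous_on_eq_continuous_at isCont_def intro: filterlim_mono[OF _ order.refl at_le])
  then have "\<forall>\<^sub>F x in at_right l. l < x \<and> C x < r"
    using eventually_at_right_less by eventually_elim simp
  then show thesis
    using that eventually_happens'[OF trivial_limit_at_right_real] by blast
qed

lemma continuous_less_left:
  fixes C :: "real \<Rightarrow> real"
  assumes "continuous_on UNIV C" and "C l < r"
  obtains t where "t < l" and "C t < r"
proof -
  have "continuous_on UNIV (\<lambda>x. C (- x))"
    using assms(1) by (auto intro!: continuous_intros continuous_on_compose2[OF assms(1)])
  with assms(2) obtain t where "- l < t" "C (- t) < r"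
    by (rule_tac continuous_less_right[of "\<lambda>x. C (- x)" "- l" r]) auto
  then show thesis using that[of "- t"] by simp
qed

text \<open>For nonincreasing \<open>D\<close>, the number \<open>D (limsup_filter F u)\<close> is
  the limit inferior of \<open>D (u i)\<close>. This lemma and the next three say so in terms of
  bounds: lower bounds hold eventually, upper bounds frequently, the reverse of the situation for
  limits superior.\<close>

lemma eventually_less_antimono:
  fixes D :: "real \<Rightarrow> real"
  assumes "bounded (range u)" and "continuous_on UNIV D" and "antimono D"
    and "r < D (limsup_filter F u)"
  shows "\<forall>\<^sub>F i in F. r < D (u i)"
proof -
  have "continuous_on UNIV (\<lambda>x. - D x)"
    using assms(2) by (intro continuous_intros)
  from continuous_less_right[OF this] assms(4)
  obtain t where t: "limsup_filter F u < t" "- D t < - r" by (metis neg_less_iff_less)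
  from eventually_less_limsup_filter[OF assms(1) t(1)] show ?thesis
  proof eventually_elim
    case (elim i)
    then have "D t \<le> D (u i)" using assms(3) by (simp add: antimono_def)
    with t(2) show ?case by simp
  qed
qed

lemma frequently_less_antimono:
  fixes D :: "real \<Rightarrow> real"
  assumes "bounded (range u)" and "F \<noteq> bot" and "continuous_on UNIV D" and "antimono D"
    and "D (limsup_filter F u) < r"
  shows "\<exists>\<^sub>F i in F. D (u i) < r"
proof -
  from continuous_less_left[OF assms(3,5)]
  obtain t where t: "t < limsup_filter F u" "D t < r" .
  from frequently_less_limsup_filter[OF assms(1,2) t(1)] show ?thesis
  proof (rule frequently_elim1)
    fix i assume "t < u i"
    then have "D (u i) \<le> D t" using assms(4) by (simp add: antimono_def)
    with t(2) show "D (u i) < r" by simp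
  qed
qed

lemma le_antimono_limsup_filter:
  fixes D :: "real \<Rightarrow> real"
  assumes "bounded (range u)" and "F \<noteq> bot" and "continuous_on UNIV D" and "antimono D"
    and "\<forall>\<^sub>F i in F. r \<le> D (u i)"
  shows "r \<le> D (limsup_filter F u)"
proof (rule ccontr)
  assume "\<not> ?thesis"
  then have "\<exists>\<^sub>F i in F. D (u i) < r"
    by (intro frequently_less_antimono[OF assms(1-4)]) simp
  with assms(5) show False by (simp add: frequently_def not_less)
qed

lemma antimono_limsup_filter_le:
  fixes D :: "real \<Rightarrow> real"
  assumes "bounded (range u)" and "continuous_on UNIV D" and "antimono D"
    and "\<exists>\<^sub>F i in F. D (u i) \<le> r"
  shows "D (limsup_filter F u) \<le> r"
proof (rule ccontr)
  assume "\<not> ?thesis"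
  then have "\<forall>\<^sub>F i in F. r < D (u i)"
    by (intro eventually_less_antimono[OF assms(1-3)]) simp
  with assms(4) show False by (simp add: frequently_def not_le)
qed

lemma limsup_filter_mono_comp:
  fixes C :: "real \<Rightarrow> real"
  assumes "bounded (range u)" and "F \<noteq> bot" and "continuous_on UNIV C" and "mono C"
  shows "limsup_filter F (\<lambda>i. C (u i)) = C (limsup_filter F u)"
proof (rule antisym)
  have bd: "bounded (range (\<lambda>i. C (u i)))" using bounded_range_mono[OF assms(1)] assms(4) by blast
  \<comment> \<open>Negation makes \<open>C\<close> nonincreasing, so the preceding lemmas
    apply.\<close>
  have D: "continuous_on UNIV (\<lambda>x. - C x)" "antimono (\<lambda>x. - C x)"
    using assms(3,4) by (auto intro: continuous_intros simp: mono_def antimono_def)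
  show "limsup_filter F (\<lambda>i. C (u i)) \<le> C (limsup_filter F u)"
  proof (rule field_le_epsilon)
    fix e :: real assume "0 < e"
    then have "\<forall>\<^sub>F i in F. - C (limsup_filter F u) - e < - C (u i)"
      by (intro eventually_less_antimono[OF assms(1) D]) simp
    then have "\<forall>\<^sub>F i in F. C (u i) \<le> C (limsup_filter F u) + e" by eventually_elim simp
    then show "limsup_filter F (\<lambda>i. C (u i)) \<le> C (limsup_filter F u) + e"
      by (intro limsup_filter_le bd assms)
  qed
  show "C (limsup_filter F u) \<le> limsup_filter F (\<lambda>i. C (u i))"
  proof (rule field_le_epsilon)
    fix e :: real assume "0 < e"
    then have "\<exists>\<^sub>F i in F. - C (u i) < - C (limsup_filter F u) + e"
      by (intro frequently_less_antimono[OF assms(1,2) D]) simp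
    then have "\<exists>\<^sub>F i in F. C (limsup_filter F u) - e \<le> C (u i)"
      by (rule frequently_elim1) simp
    then have "C (limsup_filter F u) - e \<le> limsup_filter F (\<lambda>i. C (u i))"
      by (intro le_limsup_filter bd)
    then show "C (limsup_filter F u) \<le> limsup_filter F (\<lambda>i. C (u i)) + e" by simp
  qed
qed

text \<open>Eventual upper bounds on \<open>u\<close> and on \<open>v\<close> can be intersected.
  Lower bounds are only frequent and cannot, which is why minima do not pass through in
  general.\<close>

lemma limsup_filter_max:
  assumes "bounded (range u)" and "bounded (range v)" and "F \<noteq> bot"
  shows "limsup_filter F (\<lambda>i. max (u i) (v i)) = max (limsup_filter F u) (limsup_filter F v)"
proof (rule antisym)
  note bd = bounded_range_max[OF assms(1,2)]
  show "limsup_filter F (\<lambda>i. max (u i) (v i)) \<le> max (limsup_filter F u) (limsup_filter F v)"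
  proof (rule dense_ge)
    fix r assume "max (limsup_filter F u) (limsup_filter F v) < r"
    then have "\<forall>\<^sub>F i in F. u i < r" "\<forall>\<^sub>F i in F. v i < r"
      using assms by (auto intro: eventually_less_limsup_filter)
    then have "\<forall>\<^sub>F i in F. max (u i) (v i) \<le> r" by eventually_elim simp
    then show "limsup_filter F (\<lambda>i. max (u i) (v i)) \<le> r" by (intro limsup_filter_le bd assms)
  qed
  have "limsup_filter F w \<le> limsup_filter F (\<lambda>i. max (u i) (v i))"
    if w: "bounded (range w)" "\<And>i. w i \<le> max (u i) (v i)" for w
  proof (rule dense_le)
    fix r assume "r < limsup_filter F w"
    from frequently_less_limsup_filter[OF w(1) assms(3) this]
    have "\<exists>\<^sub>F i in F. r \<le> max (u i) (v i)"
      by (rule frequently_elim1) (meson w(2) less_imp_le order_trans)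
    then show "r \<le> limsup_filter F (\<lambda>i. max (u i) (v i))" by (intro le_limsup_filter bd)
  qed
  from this[of u] this[of v] assms
  show "max (limsup_filter F u) (limsup_filter F v) \<le> limsup_filter F (\<lambda>i. max (u i) (v i))"
    by simp
qed


section \<open>Exchanging limits superior with quantifiers\<close>

text \<open>Models one quantifier: \<open>U i\<close> is the universe of the factor at
  \<open>i\<close>, and \<open>u i a\<close> the value of a formula there when the quantified
  variable is \<open>a\<close>. Elements of \<open>Pi UNIV U\<close> represent the points of the
  product.\<close>

locale bounded_family =
  fixes F :: "'i filter" and U :: "'i \<Rightarrow> 'a set" and u :: "'i \<Rightarrow> 'a \<Rightarrow> real" and B :: real
  assumes nontrivial: "F \<noteq> bot"
    and nonempty: "\<And>i. U i \<noteq> {}"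
    and bound: "\<And>i a. a \<in> U i \<Longrightarrow> \<bar>u i a\<bar> \<le> B"
begin

lemma Pi_nonempty: "Pi UNIV U \<noteq> {}"
  using nonempty by auto

lemma bounded_section: "a \<in> Pi UNIV U \<Longrightarrow> bounded (range (\<lambda>i. u i (a i)))"
  using bound by (auto simp: bounded_iff Pi_iff)

lemma abs_limsup_section: "a \<in> Pi UNIV U \<Longrightarrow> \<bar>limsup_filter F (\<lambda>i. u i (a i))\<bar> \<le> B"
  using bound by (intro abs_limsup_filter_le nontrivial) (auto simp: Pi_iff)

lemma bdd_sections:
  "bdd_below ((\<lambda>a. limsup_filter F (\<lambda>i. u i (a i))) ` Pi UNIV U)"
  "bdd_above ((\<lambda>a. limsup_filter F (\<lambda>i. u i (a i))) ` Pi UNIV U)"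
  using abs_limsup_section
  by (auto intro!: bdd_belowI2[where m = "- B"] bdd_aboveI2[where M = B] simp: abs_le_iff minus_le_iff)

lemma bdd_coordinate: "bdd_below (u i ` U i)" "bdd_above (u i ` U i)"
  using bound
  by (auto intro!: bdd_belowI2[where m = "- B"] bdd_aboveI2[where M = B] simp: abs_le_iff minus_le_iff)

lemma abs_INF_SUP_le: "\<bar>INF a\<in>U i. u i a\<bar> \<le> B" "\<bar>SUP a\<in>U i. u i a\<bar> \<le> B"
proof -
  obtain a where a: "a \<in> U i" using nonempty by blast
  have le: "- B \<le> u i b" "u i b \<le> B" if "b \<in> U i" for b using bound[OF that] by linarith+
  have "(INF a\<in>U i. u i a) \<le> u i a" "u i a \<le> (SUP a\<in>U i. u i a)"
    using bdd_coordinate a by (auto intro: cINF_lower cSUP_upper)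
  moreover have "- B \<le> (INF a\<in>U i. u i a)" "(SUP a\<in>U i. u i a) \<le> B"
    using nonempty le by (auto intro!: cINF_greatest cSUP_least)
  ultimately show "\<bar>INF a\<in>U i. u i a\<bar> \<le> B" "\<bar>SUP a\<in>U i. u i a\<bar> \<le> B" using le[OF a] by linarith+
qed

lemma bounded_INF_SUP:
  "bounded (range (\<lambda>i. INF a\<in>U i. u i a))" "bounded (range (\<lambda>i. SUP a\<in>U i. u i a))"
  using abs_INF_SUP_le by (auto simp: bounded_iff)

lemma ex_coordinate_less: "(INF a\<in>U i. u i a) < r \<Longrightarrow> \<exists>a\<in>U i. u i a < r"
  using nonempty bdd_coordinate by (simp add: cINF_less_iff)

lemma ex_coordinate_greater: "r < (SUP a\<in>U i. u i a) \<Longrightarrow> \<exists>a\<in>U i. r < u i a"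
  using nonempty bdd_coordinate by (simp add: less_cSUP_iff)

text \<open>A section cannot beat the coordinatewise infima. Conversely, points with value below r
  are chosen at all indices that have one and arbitrarily elsewhere; these indices form a set of the
  filter.\<close>

lemma limsup_filter_INF:
  "limsup_filter F (\<lambda>i. INF a\<in>U i. u i a) = (INF a\<in>Pi UNIV U. limsup_filter F (\<lambda>i. u i (a i)))"
proof (rule antisym)
  show "limsup_filter F (\<lambda>i. INF a\<in>U i. u i a) \<le> (INF a\<in>Pi UNIV U. limsup_filter F (\<lambda>i. u i (a i)))"
  proof (rule cINF_greatest[OF Pi_nonempty])
    fix a assume a: "a \<in> Pi UNIV U"
    show "limsup_filter F (\<lambda>i. INF a\<in>U i. u i a) \<le> limsup_filter F (\<lambda>i. u i (a i))"
    proof (rule dense_ge)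
      fix r assume "limsup_filter F (\<lambda>i. u i (a i)) < r"
      from eventually_less_limsup_filter[OF bounded_section[OF a] this]
      have "\<forall>\<^sub>F i in F. (INF a\<in>U i. u i a) \<le> r"
        by eventually_elim (use a bdd_coordinate in \<open>auto intro!: cINF_lower2\<close>)
      then show "limsup_filter F (\<lambda>i. INF a\<in>U i. u i a) \<le> r"
        by (intro limsup_filter_le bounded_INF_SUP nontrivial)
    qed
  qed
  show "(INF a\<in>Pi UNIV U. limsup_filter F (\<lambda>i. u i (a i))) \<le> limsup_filter F (\<lambda>i. INF a\<in>U i. u i a)"
  proof (rule dense_ge)
    fix r assume r: "limsup_filter F (\<lambda>i. INF a\<in>U i. u i a) < r"
    have "\<exists>a. a \<in> U i \<and> ((INF a\<in>U i. u i a) < r \<longrightarrow> u i a < r)" for i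
      using ex_coordinate_less nonempty by blast
    then obtain a where a: "\<And>i. a i \<in> U i" "\<And>i. (INF a\<in>U i. u i a) < r \<Longrightarrow> u i (a i) < r"
      by metis
    have aP: "a \<in> Pi UNIV U" using a(1) by simp
    from eventually_less_limsup_filter[OF bounded_INF_SUP(1) r]
    have "\<forall>\<^sub>F i in F. u i (a i) \<le> r"
      by eventually_elim (use a(2) in \<open>auto intro: less_imp_le\<close>)
    then have "limsup_filter F (\<lambda>i. u i (a i)) \<le> r"
      by (intro limsup_filter_le bounded_section aP nontrivial)
    then show "(INF a\<in>Pi UNIV U. limsup_filter F (\<lambda>i. u i (a i))) \<le> r"
      using aP bdd_sections by (auto intro: cINF_lower2)
  qed
qed

text \<open>The same gluing with points of value above r; such points exist frequently, and for a
  lower bound on a limit superior that is enough.\<close>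

lemma limsup_filter_SUP:
  "limsup_filter F (\<lambda>i. SUP a\<in>U i. u i a) = (SUP a\<in>Pi UNIV U. limsup_filter F (\<lambda>i. u i (a i)))"
proof (rule antisym)
  show "(SUP a\<in>Pi UNIV U. limsup_filter F (\<lambda>i. u i (a i))) \<le> limsup_filter F (\<lambda>i. SUP a\<in>U i. u i a)"
  proof (rule cSUP_least[OF Pi_nonempty])
    fix a assume a: "a \<in> Pi UNIV U"
    show "limsup_filter F (\<lambda>i. u i (a i)) \<le> limsup_filter F (\<lambda>i. SUP a\<in>U i. u i a)"
    proof (rule dense_le)
      fix r assume "r < limsup_filter F (\<lambda>i. u i (a i))"
      from frequently_less_limsup_filter[OF bounded_section[OF a] nontrivial this]
      have "\<exists>\<^sub>F i in F. r \<le> (SUP a\<in>U i. u i a)"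
        by (rule frequently_elim1) (use a bdd_coordinate in \<open>auto intro!: cSUP_upper2\<close>)
      then show "r \<le> limsup_filter F (\<lambda>i. SUP a\<in>U i. u i a)"
        by (intro le_limsup_filter bounded_INF_SUP)
    qed
  qed
  show "limsup_filter F (\<lambda>i. SUP a\<in>U i. u i a) \<le> (SUP a\<in>Pi UNIV U. limsup_filter F (\<lambda>i. u i (a i)))"
  proof (rule dense_le)
    fix r assume r: "r < limsup_filter F (\<lambda>i. SUP a\<in>U i. u i a)"
    have "\<exists>a. a \<in> U i \<and> (r < (SUP a\<in>U i. u i a) \<longrightarrow> r < u i a)" for i
      using ex_coordinate_greater nonempty by blast
    then obtain a where a: "\<And>i. a i \<in> U i" "\<And>i. r < (SUP a\<in>U i. u i a) \<Longrightarrow> r < u i (a i)"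
      by metis
    have aP: "a \<in> Pi UNIV U" using a(1) by simp
    from frequently_less_limsup_filter[OF bounded_INF_SUP(2) nontrivial r]
    have "\<exists>\<^sub>F i in F. r \<le> u i (a i)"
      by (rule frequently_elim1) (use a(2) in \<open>auto intro: less_imp_le\<close>)
    then have "r \<le> limsup_filter F (\<lambda>i. u i (a i))"
      by (intro le_limsup_filter bounded_section aP)
    then show "r \<le> (SUP a\<in>Pi UNIV U. limsup_filter F (\<lambda>i. u i (a i)))"
      using aP bdd_sections by (auto intro: cSUP_upper2)
  qed
qed

end

text \<open>For the suprema alone one inequality is unconditional: an eventual bound on
  \<open>D (u i (a i))\<close> and a frequent one on \<open>v i (a i)\<close> hold together
  frequently. The other is not, because a large minimum is found only frequently while
  \<open>D\<close> of a limit superior requires an eventual bound. The infimum of \<open>u\<close>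
  fills in the remaining indices.\<close>

lemma limsup_filter_max_INF_SUP:
  assumes "bounded_family F U u B" and "bounded_family F U v B"
    and D: "continuous_on UNIV D" "antimono D" "D \<Delta> = \<Delta>"
  shows "limsup_filter F (\<lambda>i. max (INF a\<in>U i. u i a) (SUP a\<in>U i. min (D (u i a)) (min \<Delta> (v i a)))) =
    max (INF a\<in>Pi UNIV U. limsup_filter F (\<lambda>i. u i (a i)))
      (SUP a\<in>Pi UNIV U. min (D (limsup_filter F (\<lambda>i. u i (a i)))) (min \<Delta> (limsup_filter F (\<lambda>i. v i (a i)))))"
    (is "?lhs = max ?inf (SUP a\<in>_. ?s a)")
proof -
  interpret u: bounded_family F U u B by fact
  interpret v: bounded_family F U v B by fact
  define w where "w i a = min (D (u i a)) (min \<Delta> (v i a))" for i a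
  \<comment> \<open>By monotonicity \<open>D x\<close> lies between \<open>D B\<close> and
    \<open>D (- B)\<close> whenever \<open>x\<close> is in \<open>[-B, B]\<close>; the other two
    summands bound \<Delta> and \<open>v\<close>.\<close>
  define K where "K = \<bar>D (- B)\<bar> + \<bar>D B\<bar> + \<bar>\<Delta>\<bar> + B"
  have K: "\<bar>min (D x) (min \<Delta> y)\<bar> \<le> K" if "\<bar>x\<bar> \<le> B" "\<bar>y\<bar> \<le> B" for x y
  proof -
    have "D B \<le> D x" "D x \<le> D (- B)" using D(2) that by (auto simp: antimono_def)
    with that show ?thesis unfolding K_def by linarith
  qed
  interpret w: bounded_family F U w K
    using u.nontrivial u.nonempty K u.bound v.bound by unfold_locales (auto simp: w_def)
  have bdd: "bdd_above (?s ` Pi UNIV U)"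
    using K[OF u.abs_limsup_section v.abs_limsup_section] abs_le_D1 by (intro bdd_aboveI2) blast
  have lhs: "?lhs = max ?inf (limsup_filter F (\<lambda>i. SUP a\<in>U i. w i a))"
    using limsup_filter_max[OF u.bounded_INF_SUP(1) w.bounded_INF_SUP(2) u.nontrivial]
    by (simp add: u.limsup_filter_INF w_def)
  have "max ?inf (limsup_filter F (\<lambda>i. SUP a\<in>U i. w i a)) \<le> max ?inf (SUP a\<in>Pi UNIV U. ?s a)"
  proof (rule dense_ge)
    fix r assume r: "max ?inf (SUP a\<in>Pi UNIV U. ?s a) < r"
    have "limsup_filter F (\<lambda>i. SUP a\<in>U i. w i a) \<le> r"
    proof (rule ccontr)
      assume "\<not> ?thesis"
      then have "r < limsup_filter F (\<lambda>i. SUP a\<in>U i. w i a)" by simp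
      from frequently_less_limsup_filter[OF w.bounded_INF_SUP(2) u.nontrivial this]
      have J: "\<exists>\<^sub>F i in F. r < (SUP a\<in>U i. w i a)" .
      have I: "\<forall>\<^sub>F i in F. (INF a\<in>U i. u i a) < r"
        using r by (intro eventually_less_limsup_filter u.bounded_INF_SUP)
          (simp add: u.limsup_filter_INF)
      \<comment> \<open>A single index suffices, because \<open>w\<close> is capped at
        \<Delta>.\<close>
      from frequently_ex[OF J] obtain i a where "r < w i a"
        using w.ex_coordinate_greater by blast
      then have "r < \<Delta>" by (simp add: w_def)
      \<comment> \<open>One section mixes both kinds of points: a large \<open>w\<close> has
        priority, so that \<open>v\<close> stays large frequently, and a small \<open>u\<close> is
        used at the other indices.\<close>
      have "\<exists>a. a \<in> U i \<and> (r < (SUP a\<in>U i. w i a) \<longrightarrow> r < w i a) \<and>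
          (\<not> r < (SUP a\<in>U i. w i a) \<longrightarrow> (INF a\<in>U i. u i a) < r \<longrightarrow> u i a < r)" for i
        using w.ex_coordinate_greater u.ex_coordinate_less w.nonempty by blast
      then obtain a where a: "\<And>i. a i \<in> U i" "\<And>i. r < (SUP a\<in>U i. w i a) \<Longrightarrow> r < w i (a i)"
        "\<And>i. \<not> r < (SUP a\<in>U i. w i a) \<Longrightarrow> (INF a\<in>U i. u i a) < r \<Longrightarrow> u i (a i) < r"
        by metis
      have aP: "a \<in> Pi UNIV U" using a(1) by simp
      \<comment> \<open>Where \<open>w i (a i)\<close> is not large, \<open>u i (a i) < r < \<Delta>\<close>, so \<open>D\<close> sends it above its fixed point.\<close>
      have "\<forall>\<^sub>F i in F. r \<le> D (u i (a i))"
        using I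
      proof eventually_elim
        case (elim i)
        show ?case
        proof (cases "r < (SUP a\<in>U i. w i a)")
          case True
          then show ?thesis using a(2)[of i] by (simp add: w_def)
        next
          case False
          then have "D \<Delta> \<le> D (u i (a i))"
            using a(3)[of i] elim \<open>r < \<Delta>\<close> D(2) by (simp add: antimono_def)
          then show ?thesis using \<open>r < \<Delta>\<close> D(3) by simp
        qed
      qed
      then have "r \<le> D (limsup_filter F (\<lambda>i. u i (a i)))"
        by (intro le_antimono_limsup_filter u.bounded_section aP u.nontrivial D)
      moreover have "\<exists>\<^sub>F i in F. r \<le> v i (a i)"
        using J by (rule frequently_elim1) (use a(2) in \<open>force simp: w_def\<close>)
      then have "r \<le> limsup_filter F (\<lambda>i. v i (a i))"
        by (intro le_limsup_filter v.bounded_section aP)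
      ultimately have "r \<le> ?s a" using \<open>r < \<Delta>\<close> by simp
      also have "\<dots> \<le> (SUP a\<in>Pi UNIV U. ?s a)" using aP bdd by (intro cSUP_upper)
      finally show False using r by simp
    qed
    with r show "max ?inf (limsup_filter F (\<lambda>i. SUP a\<in>U i. w i a)) \<le> r" by simp
  qed
  moreover have "(SUP a\<in>Pi UNIV U. ?s a) \<le> limsup_filter F (\<lambda>i. SUP a\<in>U i. w i a)"
    unfolding w.limsup_filter_SUP
  proof (rule cSUP_mono[OF w.Pi_nonempty w.bdd_sections(2)])
    fix a assume a: "a \<in> Pi UNIV U"
    have "?s a \<le> limsup_filter F (\<lambda>i. w i (a i))"
    proof (rule dense_le)
      fix r assume r: "r < ?s a"
      then have "\<forall>\<^sub>F i in F. r < D (u i (a i))" "\<exists>\<^sub>F i in F. r < v i (a i)"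
        using eventually_less_antimono[OF u.bounded_section[OF a] D(1,2)]
          frequently_less_limsup_filter[OF v.bounded_section[OF a] u.nontrivial] by simp_all
      then have "\<exists>\<^sub>F i in F. r < D (u i (a i)) \<and> r < v i (a i)"
        by (simp add: eventually_frequently_simps frequently_eventually_conj)
      then have "\<exists>\<^sub>F i in F. r \<le> w i (a i)"
        by (rule frequently_elim1) (use r in \<open>auto simp: w_def\<close>)
      then show "r \<le> limsup_filter F (\<lambda>i. w i (a i))"
        by (intro le_limsup_filter w.bounded_section a)
    qed
    with a show "\<exists>b\<in>Pi UNIV U. ?s a \<le> limsup_filter F (\<lambda>i. w i (b i))" by blast
  qed
  ultimately show ?thesis unfolding lhs by (intro antisym) auto
qed


section \<open>Values of derived formulas\<close>

lemma form_value_Unary [simp]: "form_value M (Unary C \<phi>) \<sigma> = C (form_value M \<phi> \<sigma>)"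
  by (simp add: Unary_def)

lemma form_value_Const [simp]: "form_value M (Const r) \<sigma> = r"
  by (simp add: Const_def)

lemma form_value_Diff [simp]:
  "form_value M (Diff \<phi> \<psi>) \<sigma> = form_value M \<phi> \<sigma> - form_value M \<psi> \<sigma>"
  by (simp add: Diff_def)

lemma image_nth: "(\<lambda>i. f (xs ! i)) ` {..<length xs} = f ` set xs"
  by (auto simp: set_conv_nth)

lemma form_value_MaxF [simp]:
  "form_value M (MaxF \<phi>s) \<sigma> = Max ((\<lambda>\<phi>. form_value M \<phi> \<sigma>) ` set \<phi>s)"
  by (simp add: MaxF_def image_nth[of "\<lambda>\<phi>. form_value M \<phi> \<sigma>"])

lemma form_value_MinF [simp]:
  "form_value M (MinF \<phi>s) \<sigma> = Min ((\<lambda>\<phi>. form_value M \<phi> \<sigma>) ` set \<phi>s)"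
  by (simp add: MinF_def image_nth[of "\<lambda>\<phi>. form_value M \<phi> \<sigma>"])

section \<open>Bounds for the values of formulas in a single structure\<close>

definition bounded_form :: "('a, 'f, 'p) mstructure \<Rightarrow> ('f, 'p) form \<Rightarrow> real \<Rightarrow> bool" where
  "bounded_form M \<phi> B \<longleftrightarrow> (\<forall>\<sigma>. range \<sigma> \<subseteq> universe M \<longrightarrow> \<bar>form_value M \<phi> \<sigma>\<bar> \<le> B)"

lemma bounded_form_quantifier:
  assumes "universe M \<noteq> {}" and "bounded_form M \<phi> B"
  shows "bounded_form M (SupF x \<phi>) B" and "bounded_form M (InfF x \<phi>) B"
proof -
  have "\<bar>INF a\<in>universe M. form_value M \<phi> (\<sigma>(x := a))\<bar> \<le> B \<and>
      \<bar>SUP a\<in>universe M. form_value M \<phi> (\<sigma>(x := a))\<bar> \<le> B" if "range \<sigma> \<subseteq> universe M" for \<sigma>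
  proof -
    \<comment> \<open>A single structure is viewed as a family over a one-point index set, so that
      the bounds of the locale can be reused.\<close>
    interpret bounded_family "principal {()}" "\<lambda>_. universe M" "\<lambda>_ a. form_value M \<phi> (\<sigma>(x := a))" B
      using assms that
      by unfold_locales (auto simp: bounded_form_def image_subset_iff principal_eq_bot_iff)
    show ?thesis using abs_INF_SUP_le by simp
  qed
  then show "bounded_form M (SupF x \<phi>) B" "bounded_form M (InfF x \<phi>) B"
    by (simp_all add: bounded_form_def)
qed

lemma bounded_form_InfT:
  assumes "universe M \<noteq> {}" and "bounded_form M \<phi> B"
  shows "bounded_form M (InfT xs \<phi>) B"
  using assms by (induction xs) (auto simp: InfT_def intro: bounded_form_quantifier)

lemma bounded_form_SupT:
  assumes "universe M \<noteq> {}" and "bounded_form M \<phi> B"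
  shows "bounded_form M (SupT xs \<phi>) B"
  using assms by (induction xs) (auto simp: SupT_def intro: bounded_form_quantifier)

lemma bounded_form_MaxF:
  assumes "\<phi>s \<noteq> []" and "\<And>\<phi>. \<phi> \<in> set \<phi>s \<Longrightarrow> \<exists>B. bounded_form M \<phi> B"
  shows "\<exists>B. bounded_form M (MaxF \<phi>s) B"
proof -
  from assms(2) obtain b where b: "\<And>\<phi>. \<phi> \<in> set \<phi>s \<Longrightarrow> bounded_form M \<phi> (b \<phi>)" by metis
  have "bounded_form M (MaxF \<phi>s) (Max (b ` set \<phi>s))"
    unfolding bounded_form_def
  proof safe
    fix \<sigma> :: "nat \<Rightarrow> _" assume "range \<sigma> \<subseteq> universe M"
    moreover have "form_value M (MaxF \<phi>s) \<sigma> \<in> (\<lambda>\<phi>. form_value M \<phi> \<sigma>) ` set \<phi>s"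
      unfolding form_value_MaxF using assms(1) by (intro Max_in) auto
    ultimately obtain \<phi> where "\<phi> \<in> set \<phi>s" "\<bar>form_value M (MaxF \<phi>s) \<sigma>\<bar> \<le> b \<phi>"
      using b by (auto simp: bounded_form_def)
    moreover have "b \<phi> \<le> Max (b ` set \<phi>s)" using calculation(1) by simp
    ultimately show "\<bar>form_value M (MaxF \<phi>s) \<sigma>\<bar> \<le> Max (b ` set \<phi>s)" by linarith
  qed
  then show ?thesis ..
qed

lemma bounded_form_MaxF_pair:
  assumes "bounded_form M \<phi> B" and "bounded_form M \<psi> B"
  shows "bounded_form M (MaxF [\<phi>, \<psi>]) B"
  using assms by (simp add: bounded_form_def max_def)

lemma bounded_form_Unary:
  assumes "mono C \<or> antimono C" and "bounded_form M \<phi> B"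
  shows "bounded_form M (Unary C \<phi>) (max \<bar>C B\<bar> \<bar>C (- B)\<bar>)"
  unfolding bounded_form_def form_value_Unary
proof safe
  fix \<sigma> :: "nat \<Rightarrow> _" assume "range \<sigma> \<subseteq> universe M"
  then have "- B \<le> form_value M \<phi> \<sigma>" "form_value M \<phi> \<sigma> \<le> B"
    using assms(2) by (auto simp: bounded_form_def abs_le_iff minus_le_iff)
  then have "C (- B) \<le> C (form_value M \<phi> \<sigma>) \<and> C (form_value M \<phi> \<sigma>) \<le> C B \<or>
      C B \<le> C (form_value M \<phi> \<sigma>) \<and> C (form_value M \<phi> \<sigma>) \<le> C (- B)"
    using assms(1) by (auto simp: mono_def antimono_def)
  then show "\<bar>C (form_value M \<phi> \<sigma>)\<bar> \<le> max \<bar>C B\<bar> \<bar>C (- B)\<bar>" by linarith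
qed

lemma bounded_form_mono: "bounded_form M \<phi> B \<Longrightarrow> B \<le> C \<Longrightarrow> bounded_form M \<phi> C"
  by (force simp: bounded_form_def)

lemma bounded_form_Diff:
  "bounded_form M \<phi> B \<Longrightarrow> bounded_form M \<psi> C \<Longrightarrow> bounded_form M (Diff \<phi> \<psi>) (B + C)"
  by (force simp: bounded_form_def)

text \<open>With the next lemma: a block of infima is an infimum over assignments \<tau> agreeing
  with \<sigma> off \<open>xs\<close>. Such a \<tau> plays the role of a tuple of elements, and the
  induction instantiates each \<open>x\<close> with \<open>\<tau> x\<close>.\<close>

lemma form_value_InfT_le:
  assumes "bounded_form M \<phi> B" and "universe M \<noteq> {}"
    and "range \<sigma> \<subseteq> universe M" and "range \<tau> \<subseteq> universe M"
    and "\<And>x. x \<notin> set xs \<Longrightarrow> \<tau> x = \<sigma> x"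
  shows "form_value M (InfT xs \<phi>) \<sigma> \<le> form_value M \<phi> \<tau>"
  using assms(3,5)
proof (induction xs arbitrary: \<sigma>)
  case Nil
  then have "\<tau> = \<sigma>" by auto
  then show ?case by (simp add: InfT_def)
next
  case (Cons x xs)
  let ?u = "\<lambda>a. form_value M (InfT xs \<phi>) (\<sigma>(x := a))"
  have "- B \<le> ?u a" if "a \<in> universe M" for a
  proof -
    have "range (\<sigma>(x := a)) \<subseteq> universe M" using Cons.prems(1) that by auto
    then show ?thesis
      using bounded_form_InfT[OF assms(2,1), of xs] by (auto simp: bounded_form_def abs_le_iff minus_le_iff)
  qed
  then have "bdd_below (?u ` universe M)" by (rule bdd_belowI2)
  moreover have "?u (\<tau> x) \<le> form_value M \<phi> \<tau>"
    using Cons.prems assms(4) by (intro Cons.IH) (auto simp: image_subset_iff)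
  ultimately show ?case
    using assms(4) by (auto simp: InfT_def intro!: cINF_lower2)
qed

lemma form_value_InfT_less:
  assumes "universe M \<noteq> {}" and "range \<sigma> \<subseteq> universe M" and "form_value M (InfT xs \<phi>) \<sigma> < r"
  shows "\<exists>\<tau>. range \<tau> \<subseteq> universe M \<and> (\<forall>x. x \<notin> set xs \<longrightarrow> \<tau> x = \<sigma> x) \<and> form_value M \<phi> \<tau> < r"
  using assms(2,3)
proof (induction xs arbitrary: \<sigma>)
  case Nil
  then show ?case by (auto simp: InfT_def)
next
  case (Cons x xs)
  let ?u = "\<lambda>a. form_value M (InfT xs \<phi>) (\<sigma>(x := a))"
  have "Inf (?u ` universe M) < r"
    using Cons.prems(2) by (simp add: InfT_def)
  with assms(1) obtain a where a: "a \<in> universe M" "?u a < r"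
    using cInf_lessD[of "?u ` universe M" r] by auto
  have "range (\<sigma>(x := a)) \<subseteq> universe M" using a Cons.prems(1) by auto
  from Cons.IH[OF this a(2)] obtain \<tau> where "range \<tau> \<subseteq> universe M"
    "\<forall>y. y \<notin> set xs \<longrightarrow> \<tau> y = (\<sigma>(x := a)) y" "form_value M \<phi> \<tau> < r" by blast
  then show ?case by (intro exI[of _ \<tau>]) simp
qed

lemma form_value_SupT_le:
  assumes "universe M \<noteq> {}" and "\<And>\<tau>. range \<tau> \<subseteq> universe M \<Longrightarrow> form_value M \<phi> \<tau> \<le> r"
    and "range \<sigma> \<subseteq> universe M"
  shows "form_value M (SupT ys \<phi>) \<sigma> \<le> r"
  using assms(3)
proof (induction ys arbitrary: \<sigma>)
  case Nil
  then show ?case using assms(2) by (simp add: SupT_def)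
next
  case (Cons y ys)
  have "(SUP a\<in>universe M. form_value M (SupT ys \<phi>) (\<sigma>(y := a))) \<le> r"
    using Cons.prems assms(1) by (intro cSUP_least Cons.IH) auto
  then show ?case by (simp add: SupT_def)
qed

lemma form_value_le_SupT:
  assumes "bounded_form M \<phi> B" and "universe M \<noteq> {}" and "range \<sigma> \<subseteq> universe M"
  shows "form_value M \<phi> \<sigma> \<le> form_value M (SupT ys \<phi>) \<sigma>"
proof (induction ys)
  case Nil
  then show ?case by (simp add: SupT_def)
next
  case (Cons y ys)
  let ?u = "\<lambda>a. form_value M (SupT ys \<phi>) (\<sigma>(y := a))"
  have "?u a \<le> B" if "a \<in> universe M" for a
  proof -
    have "range (\<sigma>(y := a)) \<subseteq> universe M" using assms(3) that by auto
    then show ?thesis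
      using bounded_form_SupT[OF assms(2,1), of ys] by (auto simp: bounded_form_def abs_le_iff)
  qed
  then have "bdd_above (?u ` universe M)" by (rule bdd_aboveI2)
  \<comment> \<open>Updating \<sigma> at \<open>y\<close> by its own value changes nothing, so the
    left side is the value at \<sigma>.\<close>
  then have "?u (\<sigma> y) \<le> (SUP a\<in>universe M. ?u a)"
    using assms(3) by (intro cSUP_upper) auto
  then show ?case using Cons by (simp add: SupT_def)
qed

section \<open>Bounds for Palyutin formulas that depend on the signature only\<close>

lemma universe_nonempty: "L_structure L M \<Longrightarrow> universe M \<noteq> {}"
  by (simp add: L_structure_def)

lemma trm_value_in_universe:
  assumes "L_structure L M" and "range \<sigma> \<subseteq> universe M" and "wf_trm L t"
  shows "trm_value M \<sigma> t \<in> universe M"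
  using assms(3)
proof (induction rule: wf_trm.induct)
  case (1 x)
  then show ?case using assms(2) by auto
next
  case (2 f ts)
  then have "map (trm_value M \<sigma>) ts \<in> lists (universe M)" by auto
  with 2 show ?case using assms(1) by (simp add: L_structure_def)
qed

text \<open>The bound has to be uniform in the structure: \<^const>\<open>limsup_filter\<close> is only meaningful for
  bounded families.\<close>

lemma palyutin_bounded:
  assumes "palyutin L \<phi>"
  shows "\<exists>B. \<forall>M :: ('a, 'f, 'p) mstructure. L_structure L M \<longrightarrow> bounded_form M \<phi> B"
  using assms
proof (induction rule: palyutin.induct)
  case (atomic \<phi>)
  then show ?case
  proof cases
    case (1 s t)
    have "bounded_form M \<phi> (diameter_bound L)" if M: "L_structure L M" for M :: "('a, 'f, 'p) mstructure"
      using M trm_value_in_universe[OF M] 1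
      by (auto simp: bounded_form_def L_structure_def Metric_space.nonneg)
    then show ?thesis by blast
  next
    case (2 p ts)
    have "bounded_form M \<phi> (max \<bar>pred_lower L p\<bar> \<bar>pred_upper L p\<bar>)"
      if M: "L_structure L M" for M :: "('a, 'f, 'p) mstructure"
      unfolding bounded_form_def
    proof safe
      fix \<sigma> :: "nat \<Rightarrow> _" assume "range \<sigma> \<subseteq> universe M"
      then have "map (trm_value M \<sigma>) ts \<in> lists (universe M)"
        using trm_value_in_universe[OF M] 2 by auto
      then have "form_value M \<phi> \<sigma> \<in> {pred_lower L p..pred_upper L p}"
        using M 2 by (simp add: L_structure_def)
      then show "\<bar>form_value M \<phi> \<sigma>\<bar> \<le> max \<bar>pred_lower L p\<bar> \<bar>pred_upper L p\<bar>"
        unfolding atLeastAtMost_iff by linarith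
    qed
    then show ?thesis by blast
  qed
next
  case (unary \<phi> C)
  then show ?case using bounded_form_Unary by blast
next
  case (max \<phi> \<psi>)
  then obtain B C where
    "\<And>M :: ('a, 'f, 'p) mstructure. L_structure L M \<Longrightarrow> bounded_form M \<phi> B"
    "\<And>M :: ('a, 'f, 'p) mstructure. L_structure L M \<Longrightarrow> bounded_form M \<psi> C" by blast
  then have "\<forall>M :: ('a, 'f, 'p) mstructure. L_structure L M \<longrightarrow> bounded_form M (MaxF [\<phi>, \<psi>]) (max B C)"
    by (metis bounded_form_MaxF_pair bounded_form_mono max.cobounded1 max.cobounded2)
  then show ?case ..
next
  case (inf \<phi> x)
  then obtain B where "\<And>M :: ('a, 'f, 'p) mstructure. L_structure L M \<Longrightarrow> bounded_form M \<phi> B" by blast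
  then have "\<forall>M :: ('a, 'f, 'p) mstructure. L_structure L M \<longrightarrow> bounded_form M (InfF x \<phi>) B"
    using bounded_form_quantifier(2)[OF universe_nonempty] by blast
  then show ?case ..
next
  case (sup \<phi> x)
  then obtain B where "\<And>M :: ('a, 'f, 'p) mstructure. L_structure L M \<Longrightarrow> bounded_form M \<phi> B" by blast
  then have "\<forall>M :: ('a, 'f, 'p) mstructure. L_structure L M \<longrightarrow> bounded_form M (SupF x \<phi>) B"
    using bounded_form_quantifier(1)[OF universe_nonempty] by blast
  then show ?case ..
next
  case (max_inf_sup \<phi> \<psi> D \<Delta> x)
  then obtain B C where
    BC: "\<And>M :: ('a, 'f, 'p) mstructure. L_structure L M \<Longrightarrow> bounded_form M \<phi> B"
    "\<And>M :: ('a, 'f, 'p) mstructure. L_structure L M \<Longrightarrow> bounded_form M \<psi> C" by blast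
  \<comment> \<open>The summands bound \<phi>, \<open>D\<close> applied to \<phi>, the constant and
    \<psi>; absolute values make each of them at most the sum.\<close>
  define K where "K = \<bar>B\<bar> + (max \<bar>D B\<bar> \<bar>D (- B)\<bar>) + \<bar>\<Delta>\<bar> + \<bar>C\<bar>"
  have "bounded_form M (MaxF [InfF x \<phi>, SupF x (MinF [Unary D \<phi>, Const \<Delta>, \<psi>])]) K"
    if M: "L_structure L M" for M :: "('a, 'f, 'p) mstructure"
  proof -
    have U: "universe M \<noteq> {}" using M by (simp add: L_structure_def)
    have "bounded_form M (MinF [Unary D \<phi>, Const \<Delta>, \<psi>]) K"
      unfolding bounded_form_def
    proof safe
      fix \<sigma> :: "nat \<Rightarrow> _" assume "range \<sigma> \<subseteq> universe M"
      then have "\<bar>D (form_value M \<phi> \<sigma>)\<bar> \<le> max \<bar>D B\<bar> \<bar>D (- B)\<bar>" "\<bar>form_value M \<psi> \<sigma>\<bar> \<le> C"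
        using bounded_form_Unary[OF disjI2[OF max_inf_sup.hyps(4)] BC(1)[OF M]] BC(2)[OF M]
        by (simp_all add: bounded_form_def)
      then show "\<bar>form_value M (MinF [Unary D \<phi>, Const \<Delta>, \<psi>]) \<sigma>\<bar> \<le> K"
        unfolding K_def by simp linarith
    qed
    then have "bounded_form M (SupF x (MinF [Unary D \<phi>, Const \<Delta>, \<psi>])) K"
      by (rule bounded_form_quantifier[OF U])
    moreover have "B \<le> K" unfolding K_def by linarith
    then have "bounded_form M (InfF x \<phi>) K"
      using bounded_form_quantifier(2)[OF U] bounded_form_mono BC(1)[OF M] by blast
    ultimately show ?thesis by (intro bounded_form_MaxF_pair)
  qed
  then show ?case by blast
qed


section \<open>Palyutin formulas in reduced products\<close>

locale structure_family =
  fixes L :: "('f, 'p) signature"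
    and M :: "'i \<Rightarrow> ('a, 'f, 'p) mstructure"
    and F :: "'i filter"
  assumes signature: "metric_signature L"
    and L_structures: "\<And>i. L_structure L (M i)"
    and nontrivial: "F \<noteq> bot"
begin

sublocale metric: Metric_space "universe (M i)" "distance (M i)" for i
  using L_structures[of i] by (simp add: L_structure_def)

text \<open>The quotient map, usually written \<open>a_F\<close>.\<close>

definition cls :: "('i \<Rightarrow> 'a) \<Rightarrow> ('i \<Rightarrow> 'a) set" where
  "cls a = prod_rel F M `` {a}"

lemma prod_universe_coordinate: "a \<in> prod_universe M \<Longrightarrow> a i \<in> universe (M i)"
  by (auto simp: prod_universe_def)

lemma bounded_distance:
  assumes "a \<in> prod_universe M" and "b \<in> prod_universe M"
  shows "bounded (range (\<lambda>i. distance (M i) (a i) (b i)))"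
proof -
  have "\<bar>distance (M i) (a i) (b i)\<bar> \<le> diameter_bound L" for i
    using L_structures[of i] prod_universe_coordinate[OF assms(1), of i]
      prod_universe_coordinate[OF assms(2), of i] by (simp add: L_structure_def)
  then show ?thesis by (auto simp: bounded_iff)
qed

text \<open>Distances are nonnegative, so a vanishing limit superior means eventual smallness. In
  this form transitivity and compatibility with the symbols reduce to intersecting sets of the
  filter.\<close>

lemma prod_rel_iff:
  "(a, b) \<in> prod_rel F M \<longleftrightarrow> a \<in> prod_universe M \<and> b \<in> prod_universe M \<and>
    (\<forall>\<epsilon>>0. \<forall>\<^sub>F i in F. distance (M i) (a i) (b i) < \<epsilon>)"
proof -
  have "prod_dist F M a b = 0 \<longleftrightarrow> (\<forall>\<epsilon>>0. \<forall>\<^sub>F i in F. distance (M i) (a i) (b i) < \<epsilon>)"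
    if ab: "a \<in> prod_universe M" "b \<in> prod_universe M"
  proof
    assume "prod_dist F M a b = 0"
    then show "\<forall>\<epsilon>>0. \<forall>\<^sub>F i in F. distance (M i) (a i) (b i) < \<epsilon>"
      using eventually_less_limsup_filter[OF bounded_distance[OF ab]] by (simp add: prod_dist_def)
  next
    assume *: "\<forall>\<epsilon>>0. \<forall>\<^sub>F i in F. distance (M i) (a i) (b i) < \<epsilon>"
    have "prod_dist F M a b \<le> 0"
      unfolding prod_dist_def
    proof (rule dense_ge)
      fix \<epsilon> :: real assume "0 < \<epsilon>"
      with * have "\<forall>\<^sub>F i in F. distance (M i) (a i) (b i) < \<epsilon>" by blast
      then have "\<forall>\<^sub>F i in F. distance (M i) (a i) (b i) \<le> \<epsilon>"
        by (rule eventually_mono) simp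
      then show "limsup_filter F (\<lambda>i. distance (M i) (a i) (b i)) \<le> \<epsilon>"
        by (intro limsup_filter_le bounded_distance ab nontrivial)
    qed
    moreover have "0 \<le> prod_dist F M a b"
      unfolding prod_dist_def
      by (intro le_limsup_filter_eventually bounded_distance ab nontrivial always_eventually) simp
    ultimately show "prod_dist F M a b = 0" by simp
  qed
  then show ?thesis by (auto simp: prod_rel_def)
qed

lemma eventually_close:
  "\<lbrakk>(a, b) \<in> prod_rel F M; 0 < \<epsilon>\<rbrakk> \<Longrightarrow> \<forall>\<^sub>F i in F. distance (M i) (a i) (b i) < \<epsilon>"
  by (simp add: prod_rel_iff)

lemma equiv_prod_rel: "equiv (prod_universe M) (prod_rel F M)"
proof (rule equivI)
  show "prod_rel F M \<subseteq> prod_universe M \<times> prod_universe M" by (auto simp: prod_rel_def)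
  show "refl_on (prod_universe M) (prod_rel F M)"
    by (auto simp: refl_on_def prod_rel_iff prod_universe_coordinate)
  show "sym (prod_rel F M)" by (auto simp: sym_def prod_rel_iff metric.commute)
  show "trans (prod_rel F M)"
  proof (rule transI)
    fix a b c assume ab: "(a, b) \<in> prod_rel F M" and bc: "(b, c) \<in> prod_rel F M"
    have "\<forall>\<^sub>F i in F. distance (M i) (a i) (c i) < \<epsilon>" if "0 < \<epsilon>" for \<epsilon>
    proof -
      have "\<forall>\<^sub>F i in F. distance (M i) (a i) (b i) < \<epsilon> / 2" "\<forall>\<^sub>F i in F. distance (M i) (b i) (c i) < \<epsilon> / 2"
        using eventually_close[OF _ half_gt_zero[OF that]] ab bc by blast+
      then show ?thesis
      proof eventually_elim
        case (elim i)
        have "distance (M i) (a i) (c i) \<le> distance (M i) (a i) (b i) + distance (M i) (b i) (c i)"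
          using ab bc by (intro metric.triangle prod_universe_coordinate) (auto simp: prod_rel_def)
        with elim show ?case by simp
      qed
    qed
    with ab bc show "(a, c) \<in> prod_rel F M" by (simp add: prod_rel_iff)
  qed
qed

section \<open>Classes, representatives and the interpretation of symbols\<close>

lemma cls_eq_iff:
  "\<lbrakk>a \<in> prod_universe M; b \<in> prod_universe M\<rbrakk> \<Longrightarrow> cls a = cls b \<longleftrightarrow> (a, b) \<in> prod_rel F M"
  unfolding cls_def using equiv_prod_rel eq_equiv_class_iff by metis

lemma universe_reduced_product: "universe (reduced_product F M) = cls ` prod_universe M"
  by (auto simp: reduced_product_def quotient_def cls_def)

lemma representative_cls:
  assumes "a \<in> prod_universe M"
  shows "representative (cls a) \<in> prod_universe M" and "(a, representative (cls a)) \<in> prod_rel F M"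
proof -
  have "a \<in> cls a" using equiv_class_self[OF equiv_prod_rel assms] by (simp add: cls_def)
  then have "representative (cls a) \<in> cls a" unfolding representative_def by (rule someI[of "\<lambda>b. b \<in> cls a"])
  then show "(a, representative (cls a)) \<in> prod_rel F M" by (simp add: cls_def)
  then show "representative (cls a) \<in> prod_universe M" by (simp add: prod_rel_def)
qed

lemma cls_representative:
  assumes "A \<in> universe (reduced_product F M)"
  shows "representative A \<in> prod_universe M" and "cls (representative A) = A"
proof -
  obtain a where "a \<in> prod_universe M" "A = cls a"
    using assms by (auto simp: universe_reduced_product)
  then show "representative A \<in> prod_universe M" "cls (representative A) = A"
    using representative_cls[of a] cls_eq_iff[of a] by auto
qed

text \<open>The structure evaluates the distance on chosen representatives; by the triangle
  inequality, moving both arguments within their classes changes it by an eventually small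
  amount.\<close>

lemma distance_reduced_product:
  assumes "a \<in> prod_universe M" and "b \<in> prod_universe M"
  shows "distance (reduced_product F M) (cls a) (cls b) = limsup_filter F (\<lambda>i. distance (M i) (a i) (b i))"
proof -
  let ?a = "representative (cls a)" and ?b = "representative (cls b)"
  note a = representative_cls[OF assms(1)] and b = representative_cls[OF assms(2)]
  have "limsup_filter F (\<lambda>i. distance (M i) (?a i) (?b i)) = limsup_filter F (\<lambda>i. distance (M i) (a i) (b i))"
  proof (rule limsup_filter_eq_of_close)
    fix \<epsilon> :: real assume "0 < \<epsilon>"
    then have "0 < \<epsilon> / 2" by simp
    with a(2) b(2) have "\<forall>\<^sub>F i in F. distance (M i) (a i) (?a i) < \<epsilon> / 2"
      "\<forall>\<^sub>F i in F. distance (M i) (b i) (?b i) < \<epsilon> / 2"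
      using eventually_close by blast+
    then show "\<forall>\<^sub>F i in F. \<bar>distance (M i) (?a i) (?b i) - distance (M i) (a i) (b i)\<bar> \<le> \<epsilon>"
    proof eventually_elim
      case (elim i)
      have U: "a i \<in> universe (M i)" "b i \<in> universe (M i)" "?a i \<in> universe (M i)" "?b i \<in> universe (M i)"
        using assms a(1) b(1) by (simp_all add: prod_universe_coordinate)
      have "distance (M i) (?a i) (?b i) \<le> distance (M i) (?a i) (a i) + distance (M i) (a i) (?b i)"
        "distance (M i) (a i) (?b i) \<le> distance (M i) (a i) (b i) + distance (M i) (b i) (?b i)"
        "distance (M i) (a i) (b i) \<le> distance (M i) (a i) (?a i) + distance (M i) (?a i) (b i)"
        "distance (M i) (?a i) (b i) \<le> distance (M i) (?a i) (?b i) + distance (M i) (?b i) (b i)"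
        using U by (simp_all add: metric.triangle)
      with elim show ?case
        using metric.commute[of i "?a i" "a i"] metric.commute[of i "?b i" "b i"] by linarith
    qed
  qed (use assms a b nontrivial bounded_distance in auto)
  moreover have "cls a \<in> prod_universe M // prod_rel F M" "cls b \<in> prod_universe M // prod_rel F M"
    using assms by (simp_all add: cls_def quotientI)
  ultimately show ?thesis by (simp add: reduced_product_def prod_dist_def)
qed

text \<open>Finitely many arguments are eventually close simultaneously. Indexing both tuples by
  \<open>ts\<close> lets the lemma be applied directly to a list of terms, with \<open>T t\<close>
  the section of values of \<open>t\<close>.\<close>

lemma eventually_close_representatives:
  assumes "\<forall>t \<in> set ts. T t \<in> prod_universe M" and "0 < \<epsilon>"
  shows "\<forall>\<^sub>F i in F. list_all2 (\<lambda>x y. distance (M i) x y < \<epsilon>)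
    (map (\<lambda>t. T t i) ts) (map (\<lambda>t. representative (cls (T t)) i) ts)"
proof -
  have "\<forall>\<^sub>F i in F. \<forall>t \<in> set ts. distance (M i) (T t i) (representative (cls (T t)) i) < \<epsilon>"
    using assms representative_cls by (intro eventually_ball_finite) (auto simp: prod_rel_iff)
  then show ?thesis
    by eventually_elim (simp add: list_all2_conv_all_nth)
qed

lemma coordinates_in_universe:
  assumes "\<forall>t \<in> set ts. T t \<in> prod_universe M"
  shows "map (\<lambda>t. T t i) ts \<in> lists (universe (M i))"
    and "map (\<lambda>t. representative (cls (T t)) i) ts \<in> lists (universe (M i))"
  using assms representative_cls prod_universe_coordinate by auto

text \<open>The modulus comes from the signature and is common to all factors, so one threshold for
  the arguments works at every index.\<close>

lemma fun_interp_reduced_product: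
  assumes "f \<in> funs L" and "length ts = fun_arity L f" and T: "\<forall>t \<in> set ts. T t \<in> prod_universe M"
  shows "(\<lambda>i. fun_interp (M i) f (map (\<lambda>t. T t i) ts)) \<in> prod_universe M"
    and "fun_interp (reduced_product F M) f (map (\<lambda>t. cls (T t)) ts) =
      cls (\<lambda>i. fun_interp (M i) f (map (\<lambda>t. T t i) ts))"
proof -
  let ?g = "\<lambda>i. fun_interp (M i) f (map (\<lambda>t. T t i) ts)"
  let ?h = "\<lambda>i. fun_interp (M i) f (map (\<lambda>t. representative (cls (T t)) i) ts)"
  have closed: "fun_interp (M i) f zs \<in> universe (M i)"
    if "zs \<in> lists (universe (M i))" "length zs = length ts" for zs i
    using that assms L_structures[of i] by (simp add: L_structure_def)
  show g: "?g \<in> prod_universe M"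
    unfolding prod_universe_def using closed[OF coordinates_in_universe(1)[OF T]] by simp
  have h: "?h \<in> prod_universe M"
    unfolding prod_universe_def using closed[OF coordinates_in_universe(2)[OF T]] by simp
  have "\<forall>\<^sub>F i in F. distance (M i) (?g i) (?h i) < \<epsilon>" if "0 < \<epsilon>" for \<epsilon>
  proof -
    \<comment> \<open>A modulus only gives a weak inequality, whereas equivalence is expressed by a
      strict one; halving \<epsilon> bridges this.\<close>
    have "0 < fun_modulus L f (\<epsilon> / 2)"
      using signature assms(1) that by (simp add: metric_signature_def)
    from eventually_close_representatives[OF T this] show ?thesis
    proof eventually_elim
      case (elim i)
      have "\<forall>xs \<in> lists (universe (M i)). \<forall>ys \<in> lists (universe (M i)). length xs = fun_arity L f \<longrightarrow>
          list_all2 (\<lambda>x y. distance (M i) x y < fun_modulus L f (\<epsilon> / 2)) xs ys \<longrightarrow>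
          distance (M i) (fun_interp (M i) f xs) (fun_interp (M i) f ys) \<le> \<epsilon> / 2"
        using L_structures[of i] assms(1) half_gt_zero[OF that] unfolding L_structure_def by blast
      then have "distance (M i) (?g i) (?h i) \<le> \<epsilon> / 2"
        using elim assms(2) coordinates_in_universe[OF T] by (metis length_map)
      with that show ?case by simp
    qed
  qed
  with g h have "cls ?g = cls ?h" by (simp add: cls_eq_iff prod_rel_iff)
  then show "fun_interp (reduced_product F M) f (map (\<lambda>t. cls (T t)) ts) = cls ?g"
    by (simp add: reduced_product_def cls_def o_def)
qed

lemma pred_interp_reduced_product:
  assumes "p \<in> preds L" and "length ts = pred_arity L p" and T: "\<forall>t \<in> set ts. T t \<in> prod_universe M"
  shows "pred_interp (reduced_product F M) p (map (\<lambda>t. cls (T t)) ts) =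
    limsup_filter F (\<lambda>i. pred_interp (M i) p (map (\<lambda>t. T t i) ts))"
proof -
  let ?g = "\<lambda>i. pred_interp (M i) p (map (\<lambda>t. T t i) ts)"
  let ?h = "\<lambda>i. pred_interp (M i) p (map (\<lambda>t. representative (cls (T t)) i) ts)"
  have bound: "\<bar>pred_interp (M i) p zs\<bar> \<le> max \<bar>pred_lower L p\<bar> \<bar>pred_upper L p\<bar>"
    if "zs \<in> lists (universe (M i))" "length zs = length ts" for zs i
  proof -
    have "pred_interp (M i) p zs \<in> {pred_lower L p..pred_upper L p}"
      using that assms L_structures[of i] by (simp add: L_structure_def)
    then show ?thesis unfolding atLeastAtMost_iff by linarith
  qed
  have "limsup_filter F ?h = limsup_filter F ?g"
  proof (rule limsup_filter_eq_of_close)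
    show "bounded (range ?h)"
      using bound[OF coordinates_in_universe(2)[OF T]] by (auto simp: bounded_iff)
    show "bounded (range ?g)"
      using bound[OF coordinates_in_universe(1)[OF T]] by (auto simp: bounded_iff)
    fix \<epsilon> :: real assume \<epsilon>: "0 < \<epsilon>"
    then have "0 < pred_modulus L p \<epsilon>"
      using signature assms(1) by (simp add: metric_signature_def)
    from eventually_close_representatives[OF T this]
    show "\<forall>\<^sub>F i in F. \<bar>?h i - ?g i\<bar> \<le> \<epsilon>"
    proof eventually_elim
      case (elim i)
      have "\<forall>xs \<in> lists (universe (M i)). \<forall>ys \<in> lists (universe (M i)). length xs = pred_arity L p \<longrightarrow>
          list_all2 (\<lambda>x y. distance (M i) x y < pred_modulus L p \<epsilon>) xs ys \<longrightarrow>
          \<bar>pred_interp (M i) p xs - pred_interp (M i) p ys\<bar> \<le> \<epsilon>"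
        using L_structures[of i] assms(1) \<epsilon> unfolding L_structure_def by blast
      then have "\<bar>?g i - ?h i\<bar> \<le> \<epsilon>"
        using elim assms(2) coordinates_in_universe[OF T] by (metis length_map)
      then show ?case by linarith
    qed
  qed (rule nontrivial)
  then show ?thesis by (simp add: reduced_product_def o_def)
qed

lemma trm_value_reduced_product:
  assumes "wf_trm L t" and \<sigma>: "\<And>n. \<sigma> n \<in> prod_universe M"
  shows "(\<lambda>i. trm_value (M i) (\<lambda>n. \<sigma> n i) t) \<in> prod_universe M \<and>
    trm_value (reduced_product F M) (\<lambda>n. cls (\<sigma> n)) t = cls (\<lambda>i. trm_value (M i) (\<lambda>n. \<sigma> n i) t)"
  using assms(1)
proof (induction rule: wf_trm.induct)
  case (1 x)
  then show ?case using \<sigma> by simp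
next
  case (2 f ts)
  then have T: "\<forall>t \<in> set ts. (\<lambda>i. trm_value (M i) (\<lambda>n. \<sigma> n i) t) \<in> prod_universe M" by blast
  have "map (trm_value (reduced_product F M) (\<lambda>n. cls (\<sigma> n))) ts =
      map (\<lambda>t. cls (\<lambda>i. trm_value (M i) (\<lambda>n. \<sigma> n i) t)) ts"
    using 2 by simp
  then show ?case
    using fun_interp_reduced_product[OF 2(1,2) T] by (simp del: map_eq_conv)
qed

lemma range_coordinate:
  "(\<And>n. \<sigma> n \<in> prod_universe M) \<Longrightarrow> range (\<lambda>n. \<sigma> n i) \<subseteq> universe (M i)"
  by (auto intro: prod_universe_coordinate)

lemma palyutin_bounded_family:
  assumes "palyutin L \<phi>"
  shows "\<exists>B. \<forall>i. bounded_form (M i) \<phi> B"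
  using palyutin_bounded[OF assms] L_structures by blast

lemma bounded_form_value:
  assumes "palyutin L \<phi>" and "\<And>n. \<sigma> n \<in> prod_universe M"
  shows "bounded (range (\<lambda>i. form_value (M i) \<phi> (\<lambda>n. \<sigma> n i)))"
proof -
  obtain B where "\<And>i. bounded_form (M i) \<phi> B" using palyutin_bounded_family[OF assms(1)] by blast
  then have "\<bar>form_value (M i) \<phi> (\<lambda>n. \<sigma> n i)\<bar> \<le> B" for i
    using range_coordinate[of \<sigma> i] assms(2) by (simp add: bounded_form_def)
  then show ?thesis by (auto simp: bounded_iff)
qed

lemma bounded_family_form_value:
  assumes "\<And>i. bounded_form (M i) \<phi> B" and "\<And>n. \<sigma> n \<in> prod_universe M"
  shows "bounded_family F (\<lambda>i. universe (M i)) (\<lambda>i a. form_value (M i) \<phi> ((\<lambda>n. \<sigma> n i)(x := a))) B"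
proof
  fix i a assume "a \<in> universe (M i)"
  then have "range ((\<lambda>n. \<sigma> n i)(x := a)) \<subseteq> universe (M i)"
    using assms(2) prod_universe_coordinate by auto
  then show "\<bar>form_value (M i) \<phi> ((\<lambda>n. \<sigma> n i)(x := a))\<bar> \<le> B"
    using assms(1) by (simp add: bounded_form_def)
qed (use nontrivial L_structures in \<open>auto simp: L_structure_def\<close>)

text \<open>Quantifiers update an assignment of classes, while the induction hypothesis concerns
  assignments given by sections; the update can be carried out on the sections instead.\<close>

lemma value_update:
  assumes "\<And>\<sigma>. (\<And>n. \<sigma> n \<in> prod_universe M) \<Longrightarrow> form_value (reduced_product F M) \<phi> (\<lambda>n. cls (\<sigma> n)) =
      limsup_filter F (\<lambda>i. form_value (M i) \<phi> (\<lambda>n. \<sigma> n i))"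
    and "\<And>n. \<sigma> n \<in> prod_universe M" and "a \<in> Pi UNIV (\<lambda>i. universe (M i))"
  shows "form_value (reduced_product F M) \<phi> ((\<lambda>n. cls (\<sigma> n))(x := cls a)) =
    limsup_filter F (\<lambda>i. form_value (M i) \<phi> ((\<lambda>n. \<sigma> n i)(x := a i)))"
proof -
  have eqs: "(\<lambda>n. cls (\<sigma> n))(x := cls a) = (\<lambda>n. cls ((\<sigma>(x := a)) n))"
    "(\<lambda>n. \<sigma> n i)(x := a i) = (\<lambda>n. (\<sigma>(x := a)) n i)" for i
    by (simp_all add: fun_eq_iff)
  have "(\<sigma>(x := a)) n \<in> prod_universe M" for n
    using assms(2,3) by (simp add: prod_universe_def)
  from assms(1)[OF this] show ?thesis unfolding eqs .
qed

text \<open>The analogue of Los's theorem for reduced products.\<close>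

theorem form_value_reduced_product:
  assumes "palyutin L \<phi>" and "\<And>n. \<sigma> n \<in> prod_universe M"
  shows "form_value (reduced_product F M) \<phi> (\<lambda>n. cls (\<sigma> n)) =
    limsup_filter F (\<lambda>i. form_value (M i) \<phi> (\<lambda>n. \<sigma> n i))"
  using assms
proof (induction arbitrary: \<sigma> rule: palyutin.induct)
  case (atomic \<phi>)
  note \<sigma> = atomic.prems
  from atomic.hyps show ?case
  proof cases
    case (1 s t)
    then show ?thesis
      using trm_value_reduced_product[OF 1(2) \<sigma>] trm_value_reduced_product[OF 1(3) \<sigma>]
      by (simp add: distance_reduced_product)
  next
    case (2 p ts)
    then have wf: "wf_trm L t" if "t \<in> set ts" for t using that by blast
    note v = trm_value_reduced_product[OF wf \<sigma>]
    have T: "\<forall>t \<in> set ts. (\<lambda>i. trm_value (M i) (\<lambda>n. \<sigma> n i) t) \<in> prod_universe M"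
      using v by simp
    have "map (trm_value (reduced_product F M) (\<lambda>n. cls (\<sigma> n))) ts =
        map (\<lambda>t. cls (\<lambda>i. trm_value (M i) (\<lambda>n. \<sigma> n i) t)) ts"
      using v by simp
    then show ?thesis
      using pred_interp_reduced_product[OF 2(2,3) T] 2(1) by (simp del: map_eq_conv)
  qed
next
  case (unary \<phi> C)
  then show ?case
    using limsup_filter_mono_comp[OF bounded_form_value nontrivial] by (simp add: unary_connective_def)
next
  case (max \<phi> \<psi>)
  then show ?case
    using limsup_filter_max[OF bounded_form_value bounded_form_value nontrivial] by simp
next
  case (inf \<phi> x)
  obtain B where "\<And>i. bounded_form (M i) \<phi> B" using palyutin_bounded_family[OF inf.hyps] by blast
  then interpret bounded_family F "\<lambda>i. universe (M i)"
    "\<lambda>i a. form_value (M i) \<phi> ((\<lambda>n. \<sigma> n i)(x := a))" B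
    using inf.prems by (rule bounded_family_form_value)
  \<comment> \<open>The universe is the image of the sections under \<open>cls\<close>, so the
    quantifier over classes becomes one over sections and can be exchanged with the limit
    superior.\<close>
  show ?case
    using limsup_filter_INF value_update[where \<sigma> = \<sigma>, OF inf.IH inf.prems]
    by (simp add: universe_reduced_product image_image prod_universe_def)
next
  case (sup \<phi> x)
  obtain B where "\<And>i. bounded_form (M i) \<phi> B" using palyutin_bounded_family[OF sup.hyps] by blast
  then interpret bounded_family F "\<lambda>i. universe (M i)"
    "\<lambda>i a. form_value (M i) \<phi> ((\<lambda>n. \<sigma> n i)(x := a))" B
    using sup.prems by (rule bounded_family_form_value)
  show ?case
    using limsup_filter_SUP value_update[where \<sigma> = \<sigma>, OF sup.IH sup.prems]
    by (simp add: universe_reduced_product image_image prod_universe_def)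
next
  case (max_inf_sup \<phi> \<psi> D \<Delta> x)
  obtain B C where "\<And>i. bounded_form (M i) \<phi> B" "\<And>i. bounded_form (M i) \<psi> C"
    using palyutin_bounded_family max_inf_sup.hyps by meson
  then have BC: "\<And>i. bounded_form (M i) \<phi> (max B C)" "\<And>i. bounded_form (M i) \<psi> (max B C)"
    by (auto intro: bounded_form_mono[OF _ max.cobounded1] bounded_form_mono[OF _ max.cobounded2])
  note eq = value_update[where \<sigma> = \<sigma>, OF max_inf_sup.IH(1) max_inf_sup.prems]
    value_update[where \<sigma> = \<sigma>, OF max_inf_sup.IH(2) max_inf_sup.prems]
  show ?case
    using limsup_filter_max_INF_SUP[OF
        bounded_family_form_value[where \<sigma> = \<sigma> and x = x, OF BC(1) max_inf_sup.prems]
        bounded_family_form_value[where \<sigma> = \<sigma> and x = x, OF BC(2) max_inf_sup.prems] _ max_inf_sup.hyps(4,5)]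
      max_inf_sup.hyps(3) eq
    by (simp add: universe_reduced_product image_image prod_universe_def unary_connective_def)
qed

lemma assignment_reduced_product:
  assumes "range \<sigma> \<subseteq> universe (reduced_product F M)"
  shows "representative (\<sigma> n) \<in> prod_universe M" and "cls (representative (\<sigma> n)) = \<sigma> n"
  using assms cls_representative by auto

lemma bounded_form_reduced_product:
  assumes "palyutin L \<phi>"
  shows "\<exists>B. bounded_form (reduced_product F M) \<phi> B"
proof -
  obtain B where B: "\<And>i. bounded_form (M i) \<phi> B" using palyutin_bounded_family[OF assms] by blast
  have "bounded_form (reduced_product F M) \<phi> B"
    unfolding bounded_form_def
  proof safe
    fix \<sigma> :: "nat \<Rightarrow> _" assume \<sigma>: "range \<sigma> \<subseteq> universe (reduced_product F M)"
    let ?s = "\<lambda>n. representative (\<sigma> n)"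
    have "\<bar>limsup_filter F (\<lambda>i. form_value (M i) \<phi> (\<lambda>n. ?s n i))\<bar> \<le> B"
      using B range_coordinate[of ?s] assignment_reduced_product(1)[OF \<sigma>]
      by (intro abs_limsup_filter_le nontrivial) (simp add: bounded_form_def)
    then show "\<bar>form_value (reduced_product F M) \<phi> \<sigma>\<bar> \<le> B"
      using form_value_reduced_product[OF assms, of ?s] assignment_reduced_product[OF \<sigma>] by simp
  qed
  then show ?thesis ..
qed

end


section \<open>Preservation of SCP\<close>

text \<open>Pairing each connective with its formula allows a subset of the indices j to be selected
  with \<open>filter\<close>.\<close>

lemma SCP_sentence_zip:
  "SCP_sentence xs ys \<phi> (map fst ps) (map snd ps) =
    SupT ys (Diff (InfT xs (MaxF (\<phi> # map (\<lambda>(D, \<psi>). Unary D \<psi>) ps)))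
      (MaxF (map (\<lambda>(D, \<psi>). InfT xs (MaxF [\<phi>, Unary D \<psi>])) ps)))"
  by (simp add: SCP_sentence_def zip_map_fst_snd)

text \<open>Separate witnesses put each single infimum below r, hence also their maximum, which is a
  finite one. The SCP condition puts the joint infimum below r, and an infimum strictly below r has
  a witness.\<close>

lemma SCP_common_witness:
  assumes N: "L_structure L N" "N \<Turnstile> SCP L"
    and xs: "distinct (xs @ ys)"
    and \<phi>: "palyutin L \<phi>" "free_vars \<phi> \<subseteq> set xs \<union> set ys"
    and ps: "\<And>D \<psi>. (D, \<psi>) \<in> set ps \<Longrightarrow>
      unary_connective D \<and> antimono D \<and> palyutin L \<psi> \<and> free_vars \<psi> \<subseteq> set xs \<union> set ys"
    and \<sigma>: "range \<sigma> \<subseteq> universe N"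
    and "ps \<noteq> []"
    and wit: "\<And>D \<psi>. (D, \<psi>) \<in> set ps \<Longrightarrow> \<exists>\<tau>. range \<tau> \<subseteq> universe N \<and> (\<forall>x. x \<notin> set xs \<longrightarrow> \<tau> x = \<sigma> x) \<and>
      form_value N \<phi> \<tau> < r \<and> D (form_value N \<psi> \<tau>) < r"
  shows "\<exists>\<tau>. range \<tau> \<subseteq> universe N \<and> (\<forall>x. x \<notin> set xs \<longrightarrow> \<tau> x = \<sigma> x) \<and>
    form_value N \<phi> \<tau> < r \<and> (\<forall>(D, \<psi>) \<in> set ps. D (form_value N \<psi> \<tau>) < r)"
proof (cases "length ps \<ge> 2")
  case False
  \<comment> \<open>SCP starts at two pairs; for one pair the given witness is already
    common.\<close>
  then obtain D \<psi> where "ps = [(D, \<psi>)]"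
    using \<open>ps \<noteq> []\<close> by (cases ps; cases "tl ps") auto
  then show ?thesis using wit[of D \<psi>] by auto
next
  case True
  have U: "universe N \<noteq> {}" using N(1) by (simp add: L_structure_def)
  let ?A = "MaxF (\<phi> # map (\<lambda>(D, \<psi>). Unary D \<psi>) ps)"
  let ?C = "\<lambda>(D, \<psi>). MaxF [\<phi>, Unary D \<psi>]"
  let ?B = "MaxF (map (\<lambda>(D, \<psi>). InfT xs (MaxF [\<phi>, Unary D \<psi>])) ps)"
  have bd\<phi>: "\<exists>B. bounded_form N \<phi> B" using palyutin_bounded[OF \<phi>(1)] N(1) by blast
  have bdU: "\<exists>B. bounded_form N (Unary D \<psi>) B" if "(D, \<psi>) \<in> set ps" for D \<psi>
    using palyutin_bounded[of L \<psi>] ps[OF that] N(1) bounded_form_Unary by blast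
  have bdA: "\<exists>B. bounded_form N ?A B"
    using bd\<phi> bdU by (intro bounded_form_MaxF) auto
  have bdC: "\<exists>B. bounded_form N (MaxF [\<phi>, Unary D \<psi>]) B" if "(D, \<psi>) \<in> set ps" for D \<psi>
    using bd\<phi> bdU[OF that] by (intro bounded_form_MaxF) auto
  have "\<exists>B. bounded_form N ?B B"
    using bdC bounded_form_InfT[OF U] \<open>ps \<noteq> []\<close> by (intro bounded_form_MaxF) fastforce+
  moreover have "\<exists>B. bounded_form N (InfT xs ?A) B" using bdA bounded_form_InfT[OF U] by blast
  \<comment> \<open>Boundedness makes the supremum over \<open>ys\<close> dominate the value at
    \<sigma>.\<close>
  ultimately obtain K where K: "bounded_form N (Diff (InfT xs ?A) ?B) K"
    using bounded_form_Diff by blast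
  have "(SCP_sentence xs ys \<phi> (map fst ps) (map snd ps), 0) \<in> SCP L"
    unfolding SCP_def using True xs \<phi> ps
    by (intro CollectI exI[of _ xs] exI[of _ ys] exI[of _ \<phi>] exI[of _ "map fst ps"] exI[of _ "map snd ps"]) fastforce
  then have "form_value N (SupT ys (Diff (InfT xs ?A) ?B)) \<sigma> \<le> 0"
    using N(2) \<sigma> unfolding models_def SCP_sentence_zip by blast
  then have "form_value N (InfT xs ?A) \<sigma> \<le> form_value N ?B \<sigma>"
    using form_value_le_SupT[OF K U \<sigma>, of ys] by simp
  also have "form_value N ?B \<sigma> < r"
  proof -
    have "form_value N (InfT xs (MaxF [\<phi>, Unary D \<psi>])) \<sigma> < r" if D: "(D, \<psi>) \<in> set ps" for D \<psi>
    proof -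
      obtain \<tau> where \<tau>: "range \<tau> \<subseteq> universe N" "\<forall>x. x \<notin> set xs \<longrightarrow> \<tau> x = \<sigma> x"
        "form_value N \<phi> \<tau> < r" "D (form_value N \<psi> \<tau>) < r" using wit[OF D] by blast
      obtain B where "bounded_form N (MaxF [\<phi>, Unary D \<psi>]) B" using bdC[OF D] by blast
      from form_value_InfT_le[OF this U \<sigma> \<tau>(1)] \<tau>(2)
      have "form_value N (InfT xs (MaxF [\<phi>, Unary D \<psi>])) \<sigma> \<le> form_value N (MaxF [\<phi>, Unary D \<psi>]) \<tau>"
        by blast
      also have "\<dots> < r" using \<tau> by simp
      finally show ?thesis .
    qed
    then show ?thesis using \<open>ps \<noteq> []\<close> by (auto simp del: form_value.simps)
  qed
  finally obtain \<tau> where "range \<tau> \<subseteq> universe N" "\<forall>x. x \<notin> set xs \<longrightarrow> \<tau> x = \<sigma> x" "form_value N ?A \<tau> < r"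
    using form_value_InfT_less[OF U \<sigma>] by blast
  then show ?thesis by (intro exI[of _ \<tau>]) (auto simp: image_image)
qed

theorem lemma3p6:
  fixes L :: "('f, 'p) signature"
    and M :: "'i \<Rightarrow> ('a, 'f, 'p) mstructure"
    and F :: "'i filter"
  assumes "metric_signature L"
    and "\<And>i. L_structure L (M i)"
    and "F \<noteq> bot"
    and "\<forall>\<^sub>F i in F. M i \<Turnstile> SCP L"
  shows "reduced_product F M \<Turnstile> SCP L"
proof -
  interpret structure_family L M F using assms(1-3) by unfold_locales
  let ?R = "reduced_product F M"
  have UM: "universe (M i) \<noteq> {}" for i using assms(2)[of i] by (simp add: L_structure_def)
  then have "prod_universe M \<noteq> {}" by (auto simp: prod_universe_def)
  then have UR: "universe ?R \<noteq> {}" by (simp add: universe_reduced_product)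
  have value_le: "form_value ?R (SCP_sentence xs ys \<phi> (map fst ps) (map snd ps)) \<sigma>' \<le> 0"
    if xs: "distinct (xs @ ys)" and "ps \<noteq> []"
      and \<phi>: "palyutin L \<phi>" "free_vars \<phi> \<subseteq> set xs \<union> set ys"
      and ps: "\<And>D \<psi>. (D, \<psi>) \<in> set ps \<Longrightarrow>
        unary_connective D \<and> antimono D \<and> palyutin L \<psi> \<and> free_vars \<psi> \<subseteq> set xs \<union> set ys"
      and \<sigma>': "range \<sigma>' \<subseteq> universe ?R" for xs ys \<phi> ps \<sigma>'
    unfolding SCP_sentence_zip
  proof (rule form_value_SupT_le[OF UR _ \<sigma>'])
    let ?A = "MaxF (\<phi> # map (\<lambda>(D, \<psi>). Unary D \<psi>) ps)"
    let ?B = "MaxF (map (\<lambda>(D, \<psi>). InfT xs (MaxF [\<phi>, Unary D \<psi>])) ps)"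
    fix \<sigma> :: "nat \<Rightarrow> _" assume \<sigma>: "range \<sigma> \<subseteq> universe ?R"
    note s = assignment_reduced_product[OF \<sigma>]
    have "form_value ?R (InfT xs ?A) \<sigma> \<le> form_value ?R ?B \<sigma>"
    proof (rule dense_ge)
      fix r assume r: "form_value ?R ?B \<sigma> < r"
      \<comment> \<open>Off \<open>xs\<close> the lifts agree literally with the chosen
        representatives, not merely up to equivalence. Hence at every index all witnesses share the
        same parameters, as an instance of SCP requires.\<close>
      let ?Q = "\<lambda>p T. (\<forall>n. T n \<in> prod_universe M) \<and> (\<forall>x. x \<notin> set xs \<longrightarrow> T x = representative (\<sigma> x)) \<and>
        (\<forall>\<^sub>F i in F. form_value (M i) \<phi> (\<lambda>n. T n i) < r) \<and>
        (\<exists>\<^sub>F i in F. fst p (form_value (M i) (snd p) (\<lambda>n. T n i)) < r)"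
      have "\<exists>T. ?Q p T" if p: "p \<in> set ps" for p
      proof -
        obtain D \<psi> where D: "p = (D, \<psi>)" by fastforce
        have "form_value ?R (InfT xs (MaxF [\<phi>, Unary D \<psi>])) \<sigma> < r"
          using r p D \<open>ps \<noteq> []\<close> by (force simp del: form_value.simps)
        from form_value_InfT_less[OF UR \<sigma> this] obtain \<tau>
          where \<tau>: "range \<tau> \<subseteq> universe ?R" "\<forall>x. x \<notin> set xs \<longrightarrow> \<tau> x = \<sigma> x"
            and less: "form_value ?R \<phi> \<tau> < r" "D (form_value ?R \<psi> \<tau>) < r" by auto
        let ?T = "\<lambda>n. representative (\<tau> n)"
        note T = assignment_reduced_product[OF \<tau>(1)]
        note D' = ps[of D \<psi>, folded D, OF p]
        have eq: "form_value ?R \<theta> \<tau> = limsup_filter F (\<lambda>i. form_value (M i) \<theta> (\<lambda>n. ?T n i))"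
          if "palyutin L \<theta>" for \<theta>
          using form_value_reduced_product[of \<theta> ?T, OF that T(1)] T(2) by simp
        have "\<forall>\<^sub>F i in F. form_value (M i) \<phi> (\<lambda>n. ?T n i) < r"
          using eventually_less_limsup_filter[OF bounded_form_value[of \<phi> ?T, OF \<phi>(1) T(1)]]
            less(1) eq[OF \<phi>(1)] by simp
        moreover have "\<exists>\<^sub>F i in F. D (form_value (M i) \<psi> (\<lambda>n. ?T n i)) < r"
          using frequently_less_antimono[OF bounded_form_value[of \<psi> ?T, OF _ T(1)] nontrivial, of D r]
            less(2) eq[of \<psi>] D' by (simp add: unary_connective_def)
        ultimately show ?thesis using T(1) \<tau>(2) D by (intro exI[of _ ?T]) simp
      qed
      then have "\<exists>T. \<forall>p \<in> set ps. ?Q p (T p)" by (intro bchoice ballI)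
      then obtain T where T: "\<And>p n. p \<in> set ps \<Longrightarrow> T p n \<in> prod_universe M"
          "\<And>p x. p \<in> set ps \<Longrightarrow> x \<notin> set xs \<Longrightarrow> T p x = representative (\<sigma> x)"
          "\<And>p. p \<in> set ps \<Longrightarrow> \<forall>\<^sub>F i in F. form_value (M i) \<phi> (\<lambda>n. T p n i) < r"
          "\<And>p. p \<in> set ps \<Longrightarrow> \<exists>\<^sub>F i in F. fst p (form_value (M i) (snd p) (\<lambda>n. T p n i)) < r"
        by blast
      define P where "P i p \<longleftrightarrow> fst p (form_value (M i) (snd p) (\<lambda>n. T p n i)) < r" for i p
      \<comment> \<open>\<open>G\<close> gathers the finitely many conditions that hold eventually;
        \<open>P\<close> holds for each pair only frequently.\<close>
      define G where "G i \<longleftrightarrow> M i \<Turnstile> SCP L \<and> (\<forall>p \<in> set ps. form_value (M i) \<phi> (\<lambda>n. T p n i) < r)" for i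
      have G: "\<forall>\<^sub>F i in F. G i"
        unfolding G_def using assms(4) T(3) by (intro eventually_conj eventually_ball_finite) auto
      \<comment> \<open>Coordinatewise, SCP is only applied to those pairs whose own witness works at \<open>i\<close>.\<close>
      have "\<exists>t. range t \<subseteq> universe (M i) \<and> (\<forall>x. x \<notin> set xs \<longrightarrow> t x = representative (\<sigma> x) i) \<and>
          (G i \<longrightarrow> form_value (M i) \<phi> t < r \<and> (\<forall>p \<in> set ps. P i p \<longrightarrow> fst p (form_value (M i) (snd p) t) < r))"
        for i
      proof -
        let ?s = "\<lambda>n. representative (\<sigma> n) i"
        have sU: "range ?s \<subseteq> universe (M i)" using s(1) by (rule range_coordinate)
        have TU: "range (\<lambda>n. T p n i) \<subseteq> universe (M i)" if "p \<in> set ps" for p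
          using T(1)[OF that] by (rule range_coordinate)
        consider "\<not> G i" | "G i" "filter (P i) ps = []" | "G i" "filter (P i) ps \<noteq> []" by blast
        then show ?thesis
        proof cases
          case 1
          then show ?thesis using sU by (intro exI[of _ ?s]) simp
        next
          \<comment> \<open>Here only \<phi> has to be small, so the witness of any pair serves; the
            first exists because \<open>ps\<close> is nonempty.\<close>
          case 2
          then show ?thesis
            using T(2)[of "hd ps"] TU[of "hd ps"] \<open>ps \<noteq> []\<close>
            by (intro exI[of _ "\<lambda>n. T (hd ps) n i"]) (auto simp: G_def filter_empty_conv)
        next
          case 3
          have "\<exists>\<tau>. range \<tau> \<subseteq> universe (M i) \<and> (\<forall>x. x \<notin> set xs \<longrightarrow> \<tau> x = ?s x) \<and>
              form_value (M i) \<phi> \<tau> < r \<and> (\<forall>(D, \<psi>) \<in> set (filter (P i) ps). D (form_value (M i) \<psi> \<tau>) < r)"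
          proof (rule SCP_common_witness[OF assms(2) _ xs \<phi> _ sU 3(2)])
            show "M i \<Turnstile> SCP L" using 3(1) by (simp add: G_def)
          next
            fix D \<psi> assume D: "(D, \<psi>) \<in> set (filter (P i) ps)"
            then have "(D, \<psi>) \<in> set ps" by simp
            then show "unary_connective D \<and> antimono D \<and> palyutin L \<psi> \<and> free_vars \<psi> \<subseteq> set xs \<union> set ys"
              by (rule ps)
            show "\<exists>\<tau>. range \<tau> \<subseteq> universe (M i) \<and> (\<forall>x. x \<notin> set xs \<longrightarrow> \<tau> x = ?s x) \<and>
                form_value (M i) \<phi> \<tau> < r \<and> D (form_value (M i) \<psi> \<tau>) < r"
              using D TU[of "(D, \<psi>)"] T(2)[of "(D, \<psi>)"] 3(1)
              by (intro exI[of _ "\<lambda>n. T (D, \<psi>) n i"]) (auto simp: P_def G_def)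
          qed
          then obtain \<tau> where "range \<tau> \<subseteq> universe (M i)" "\<forall>x. x \<notin> set xs \<longrightarrow> \<tau> x = ?s x"
            "form_value (M i) \<phi> \<tau> < r" "\<forall>(D, \<psi>) \<in> set (filter (P i) ps). D (form_value (M i) \<psi> \<tau>) < r"
            by blast
          then show ?thesis by (intro exI[of _ \<tau>]) (auto simp: case_prod_unfold)
        qed
      qed
      then obtain t where t: "\<And>i. range (t i) \<subseteq> universe (M i)"
          "\<And>i x. x \<notin> set xs \<Longrightarrow> t i x = representative (\<sigma> x) i"
          "\<And>i. G i \<Longrightarrow> form_value (M i) \<phi> (t i) < r"
          "\<And>i p. \<lbrakk>G i; p \<in> set ps; P i p\<rbrakk> \<Longrightarrow> fst p (form_value (M i) (snd p) (t i)) < r"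
        by metis
      \<comment> \<open>Transposition turns an assignment for every factor into a section for every
        variable.\<close>
      define a where "a n = (\<lambda>i. t i n)" for n
      have a: "a n \<in> prod_universe M" for n using t(1) by (auto simp: a_def prod_universe_def)
      let ?\<tau> = "\<lambda>n. cls (a n)"
      have \<tau>: "range ?\<tau> \<subseteq> universe ?R" using a by (auto simp: universe_reduced_product)
      have "a x = representative (\<sigma> x)" if "x \<notin> set xs" for x using t(2) that by (auto simp: a_def)
      then have agree: "?\<tau> x = \<sigma> x" if "x \<notin> set xs" for x using that s(2) by simp
      have "limsup_filter F (\<lambda>i. form_value (M i) \<phi> (\<lambda>n. a n i)) \<le> r"
        using G by (intro limsup_filter_le bounded_form_value \<phi> a nontrivial)
          (auto simp: a_def elim!: eventually_mono intro: less_imp_le t(3))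
      then have "form_value ?R \<phi> ?\<tau> \<le> r"
        using form_value_reduced_product[OF \<phi>(1) a] by simp
      moreover have "D (form_value ?R \<psi> ?\<tau>) \<le> r" if D: "(D, \<psi>) \<in> set ps" for D \<psi>
      proof -
        have "\<exists>\<^sub>F i in F. P i (D, \<psi>)" using T(4)[OF D] by (simp add: P_def)
        \<comment> \<open>At these indices the pair was among those glued, so the new point keeps
          \<open>D\<close> of \<psi> below r; frequency suffices for a nonincreasing
          connective.\<close>
        then have "\<exists>\<^sub>F i in F. G i \<and> P i (D, \<psi>)" using G by (simp add: frequently_eventually_conj)
        then have "\<exists>\<^sub>F i in F. D (form_value (M i) \<psi> (\<lambda>n. a n i)) \<le> r"
          by (rule frequently_elim1) (use t(4)[OF _ D] in \<open>auto simp: a_def intro: less_imp_le\<close>)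
        then have "D (limsup_filter F (\<lambda>i. form_value (M i) \<psi> (\<lambda>n. a n i))) \<le> r"
          using ps[OF D] a
          by (intro antimono_limsup_filter_le bounded_form_value) (auto simp: unary_connective_def)
        then show ?thesis using form_value_reduced_product[of \<psi> a] ps[OF D] a by simp
      qed
      ultimately have "form_value ?R ?A ?\<tau> \<le> r" by auto
      moreover have "\<exists>B. bounded_form ?R ?A B"
      proof (rule bounded_form_MaxF)
        fix \<theta> assume "\<theta> \<in> set (\<phi> # map (\<lambda>(D, \<psi>). Unary D \<psi>) ps)"
        then consider "\<theta> = \<phi>" | D \<psi> where "(D, \<psi>) \<in> set ps" "\<theta> = Unary D \<psi>" by auto
        then show "\<exists>B. bounded_form ?R \<theta> B"
          using bounded_form_reduced_product \<phi>(1) ps bounded_form_Unary by cases blast+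
      qed simp
      then obtain K where "bounded_form ?R ?A K" ..
      from form_value_InfT_le[OF this UR \<sigma> \<tau> agree]
      have "form_value ?R (InfT xs ?A) \<sigma> \<le> form_value ?R ?A ?\<tau>" .
      ultimately show "form_value ?R (InfT xs ?A) \<sigma> \<le> r" by linarith
    qed
    then show "form_value ?R (Diff (InfT xs ?A) ?B) \<sigma> \<le> 0" by simp
  qed
  show ?thesis
    unfolding models_def
  proof clarify
    fix \<theta> r and \<sigma> :: "nat \<Rightarrow> ('i \<Rightarrow> 'a) set"
    assume "(\<theta>, r) \<in> SCP L" and \<sigma>: "range \<sigma> \<subseteq> universe ?R"
    then obtain xs ys \<phi> Ds \<psi>s where \<theta>: "\<theta> = SCP_sentence xs ys \<phi> Ds \<psi>s" "r = 0"
      and len: "2 \<le> length Ds" "length \<psi>s = length Ds"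
      and *: "distinct (xs @ ys)" "palyutin L \<phi>" "\<forall>\<psi> \<in> set \<psi>s. palyutin L \<psi>"
        "\<forall>\<theta> \<in> set (\<phi> # \<psi>s). free_vars \<theta> \<subseteq> set xs \<union> set ys"
        "\<forall>D \<in> set Ds. unary_connective D \<and> antimono D"
      unfolding SCP_def by blast
    have "form_value ?R (SCP_sentence xs ys \<phi> (map fst (zip Ds \<psi>s)) (map snd (zip Ds \<psi>s))) \<sigma> \<le> 0"
      using * len by (intro value_le[OF *(1) _ _ _ _ \<sigma>]) (auto dest: set_zip_leftD set_zip_rightD)
    then show "form_value ?R \<theta> \<sigma> \<le> r" using \<theta> len by simp
  qed
qed

end
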